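(* For any partition $P$ of a positive integer $n$, $\min(\lambda(P))=\mu(P)$, where $\min(\lambda(P))$ is the smallest (positive) part of the partition $\lambda(P)$.
   Context: Partitions and poset. Write a partition as $P=(p_s^{n_s},\dots,p_1^{n_1})$ with $p_s>\cdots>p_1\ge 1$ and $n_i\ge 1$, where $n_i$ is the multiplicity of the part $p_i$. The poset $\mathcal{D}_P$ has as elements the triples $(u,p_i,k)$ with $1\le i\le s$, $1\le u\le p_i$, $1\le k\le n_i$ (so $|\mathcal{D}_P|=n$ if $P\vdash n$). Its order is the partial order with the following covering relations: $(v,p_j,\ell)$ covers $(u,p_i,k)$ if and only if one of the following holds: ($\alpha$) $j=i+1$, $v=u+p_{i+1}-p_i$, $\ell=1$, $k=n_i$; ($\beta$) $j=i-1$, $v=u$, $\ell=1$, $k=n_i$; ($e$) $j=i$, $v=u$, $\ell=k+1$; ($\omega$) $j=i$, neither $p_i+1$ nor $p_i-1$ is a part of $P$, $v=u+1$, $\ell=1$, $k=n_i$. The partition $\lambda(P)$. $\lambda(P)=(\lambda_1,\lambda_2,\dots)$ with $\lambda_k=c_k-c_{k-1}$, where $c_k$ is the maximum cardinality of a union of $k$ chains in $\mathcal{D}_P$ (and $c_0=0$). The number $r(P)$. A partition is almost rectangular if its largest and smallest parts differ by at most $1$. $r(P)$ is the minimum number of almost rectangular subpartitions in a decomposition of $P$ as a union (multiset union of parts) of almost rectangular subpartitions. The invariant $\mu(P)$. An $s$-spread (or spread) is a partition $P=(p_s^{n_s},\dots,p_1^{n_1})$ with $p_1>0$, $p_{i+1}=p_i+1$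 for $1\le i<s$, and $n_i>0$ for all $i$; then $r(P)=\lceil s/2\rceil$. For an $s$-spread with smallest part $p=p_1$, put $n_{s+1}=0$ and $\mu(P)=\min\{p\,n_{2i-1}+(p+1)\,n_{2j} : 1\le i\le j\le r(P)\}$. For an arbitrary partition write $P=P_\ell\cup\cdots\cup P_1$ where each $P_k$ is a spread and the largest part of $P_k$ is at most the smallest part of $P_{k+1}$ minus $2$. With $\bar r_k=\sum_{i=1}^{k-1} r(P_i)$, define $\mu(P)=\min\{\mu(P_k-2\bar r_k): 1\le k\le \ell\}$, where $P-c$ denotes the partition obtained from $P$ by subtracting $c$ from each part. *)

theory Defs
  imports "HOL-Library.Multiset"
begin

definition is_partition :: "nat multiset \<Rightarrow> nat \<Rightarrow> bool" where
  "is_partition P n \<longleftrightarrow> 0 \<notin># P \<and> sum_mset P = n"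

section \<open>The poset of a partition\<close>

text \<open>The triple \<open>(u, p, k)\<close> carries the part \<open>p\<close> itself rather than its index among the
  distinct parts; the multiplicity of \<open>p\<close> is \<open>count P p\<close>.\<close>

definition D_elems :: "nat multiset \<Rightarrow> (nat \<times> nat \<times> nat) set" where
  "D_elems P = {(u, p, k). p \<in># P \<and> 1 \<le> u \<and> u \<le> p \<and> 1 \<le> k \<and> k \<le> count P p}"

text \<open>\<open>next_part P p q\<close>: for some \<open>i\<close>, \<open>p\<close> and \<open>q\<close> are the \<open>i\<close>-th and the \<open>(i+1)\<close>-st of the distinct
  parts of \<open>P\<close>, listed in increasing order.\<close>

definition next_part :: "nat multiset \<Rightarrow> nat \<Rightarrow> nat \<Rightarrow> bool" where
  "next_part P p q \<longleftrightarrow> p \<in># P \<and> q \<in># P \<and> p < q \<and> (\<forall>x. x \<in># P \<longrightarrow> \<not> (p < x \<and> x < q))"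

text \<open>A pair \<open>(x, y)\<close> in the relation means that \<open>y\<close> covers \<open>x\<close>.\<close>

inductive_set D_cover :: "nat multiset \<Rightarrow> ((nat \<times> nat \<times> nat) \<times> (nat \<times> nat \<times> nat)) set"
  for P :: "nat multiset" where
  alpha: "(u, p, k) \<in> D_elems P \<Longrightarrow> (v, q, l) \<in> D_elems P \<Longrightarrow> next_part P p q \<Longrightarrow>
     v = u + (q - p) \<Longrightarrow> l = 1 \<Longrightarrow> k = count P p \<Longrightarrow> ((u, p, k), (v, q, l)) \<in> D_cover P"
| beta: "(u, p, k) \<in> D_elems P \<Longrightarrow> (v, q, l) \<in> D_elems P \<Longrightarrow> next_part P q p \<Longrightarrow>
     v = u \<Longrightarrow> l = 1 \<Longrightarrow> k = count P p \<Longrightarrow> ((u, p, k), (v, q, l)) \<in> D_cover P"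
| e: "(u, p, k) \<in> D_elems P \<Longrightarrow> (v, q, l) \<in> D_elems P \<Longrightarrow> q = p \<Longrightarrow>
     v = u \<Longrightarrow> l = k + 1 \<Longrightarrow> ((u, p, k), (v, q, l)) \<in> D_cover P"
| omega: "(u, p, k) \<in> D_elems P \<Longrightarrow> (v, q, l) \<in> D_elems P \<Longrightarrow> q = p \<Longrightarrow>
     p + 1 \<notin># P \<Longrightarrow> p - 1 \<notin># P \<Longrightarrow>
     v = u + 1 \<Longrightarrow> l = 1 \<Longrightarrow> k = count P p \<Longrightarrow> ((u, p, k), (v, q, l)) \<in> D_cover P"

definition D_order :: "nat multiset \<Rightarrow> ((nat \<times> nat \<times> nat) \<times> (nat \<times> nat \<times> nat)) set" where
  "D_order P = Restr ((D_cover P)\<^sup>*) (D_elems P)"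

lemma D_cover_increasing:
  assumes "((u, p, k), (v, q, l)) \<in> D_cover P"
  shows "2 * int u - int p < 2 * int v - int q \<or>
         2 * int u - int p = 2 * int v - int q \<and> k < l"
  using assms by cases (auto simp: next_part_def)

lemma partial_order_on_D_order: "partial_order_on (D_elems P) (D_order P)"
proof -
  define R :: "((nat \<times> nat \<times> nat) \<times> (nat \<times> nat \<times> nat)) set" where
    "R = {((u, p, k), (v, q, l)). 2 * int u - int p < 2 * int v - int q \<or>
         2 * int u - int p = 2 * int v - int q \<and> k < l}"
  have "trans R" unfolding R_def trans_def by auto
  moreover have "D_cover P \<subseteq> R"
    using D_cover_increasing unfolding R_def by fast
  ultimately have "(D_cover P)\<^sup>+ \<subseteq> R"
    by (metis trancl_id trancl_mono_subset)
  moreover have "(x, x) \<notin> R" for x by (cases x) (auto simp: R_def)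
  ultimately have "acyclic (D_cover P)" unfolding acyclic_def by blast
  then have "antisym ((D_cover P)\<^sup>*)" by (rule acyclic_impl_antisym_rtrancl)
  then have "antisym (D_order P)" unfolding D_order_def by (auto simp: antisym_def)
  moreover have "trans (D_order P)"
    unfolding D_order_def by (intro trans_Restr trans_rtrancl)
  moreover have "refl_on (D_elems P) (D_order P)" "D_order P \<subseteq> D_elems P \<times> D_elems P"
    unfolding D_order_def by (auto intro: refl_onI)
  ultimately show ?thesis
    by (simp add: partial_order_on_def preorder_on_def)
qed

section \<open>The partition \<open>\<lambda>(P)\<close>\<close>

text \<open>The list of chains may contain repetitions and the empty chain, so that \<open>k\<close> chains exist for
  every \<open>k\<close>.\<close>

definition chain_card :: "nat multiset \<Rightarrow> nat \<Rightarrow> nat" where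
  "chain_card P k =
     Max {card (\<Union>(set Cs)) |Cs. length Cs = k \<and> set Cs \<subseteq> Chains (D_order P)}"

text \<open>\<open>lam P k\<close> is the \<open>k\<close>-th part \<open>\<lambda>\<^sub>k\<close> for \<open>k \<ge> 1\<close> (possibly zero). As \<open>chain_card P\<close> is
  non-decreasing, the subtraction does not truncate.\<close>

definition lam :: "nat multiset \<Rightarrow> nat \<Rightarrow> nat" where
  "lam P k = chain_card P k - chain_card P (k - 1)"

definition min_lam :: "nat multiset \<Rightarrow> nat" where
  "min_lam P = Min {lam P k |k. k \<ge> 1 \<and> lam P k > 0}"

section \<open>Almost rectangular decompositions\<close>

definition almost_rectangular :: "nat multiset \<Rightarrow> bool" where
  "almost_rectangular Q \<longleftrightarrow> Q \<noteq> {#} \<and> Max_mset Q - Min_mset Q \<le> 1"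

definition r_num :: "nat multiset \<Rightarrow> nat" where
  "r_num P = (LEAST m. \<exists>Qs. length Qs = m \<and> sum_list Qs = P \<and> (\<forall>Q\<in>set Qs. almost_rectangular Q))"

section \<open>Spreads and the invariant \<open>\<mu>\<close>\<close>

definition spread :: "nat multiset \<Rightarrow> bool" where
  "spread P \<longleftrightarrow> (\<exists>p s. p \<ge> 1 \<and> s \<ge> 1 \<and> set_mset P = {p..<p + s})"

text \<open>In a spread with smallest part \<open>p\<close>, the \<open>i\<close>-th distinct part is \<open>p + i - 1\<close>. The formula also
  gives \<open>n\<^bsub>s+1\<^esub> = 0\<close>.\<close>

definition mult :: "nat multiset \<Rightarrow> nat \<Rightarrow> nat" where
  "mult P i = count P (Min_mset P + i - 1)"

definition mu_spread :: "nat multiset \<Rightarrow> nat" where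
  "mu_spread P = (let p = Min_mset P in
     Min {p * mult P (2 * i - 1) + (p + 1) * mult P (2 * j) |i j. 1 \<le> i \<and> i \<le> j \<and> j \<le> r_num P})"

definition shift_parts :: "nat multiset \<Rightarrow> nat \<Rightarrow> nat multiset" where
  "shift_parts P c = image_mset (\<lambda>x. x - c) P"

text \<open>The list is \<open>[P\<^sub>1, \<dots>, P\<^sub>l]\<close>, with the smallest parts first.\<close>

definition spread_decomp :: "nat multiset \<Rightarrow> nat multiset list \<Rightarrow> bool" where
  "spread_decomp P Ps \<longleftrightarrow> sum_list Ps = P \<and> (\<forall>Q\<in>set Ps. spread Q) \<and>
     successively (\<lambda>Q R. Max_mset Q + 2 \<le> Min_mset R) Ps"

text \<open>With indices starting at 0, \<open>rbar Ps k\<close> belongs to the spread \<open>Ps ! k\<close>. The shift by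
  \<open>2 * rbar Ps k\<close> in \<open>mu\<close> keeps all parts positive: an \<open>s\<close>-spread \<open>Q\<close> has \<open>2 * r_num Q \<le> s + 1\<close>, which
  is at most the difference between the smallest part of the following spread and that of \<open>Q\<close>.\<close>

definition rbar :: "nat multiset list \<Rightarrow> nat \<Rightarrow> nat" where
  "rbar Ps k = (\<Sum>i<k. r_num (Ps ! i))"

definition mu :: "nat multiset \<Rightarrow> nat" where
  "mu P = (let Ps = (THE Ps. spread_decomp P Ps) in
     Min {mu_spread (shift_parts (Ps ! k) (2 * rbar Ps k)) |k. k < length Ps})"

text \<open>The description in \<open>mu\<close> denotes: the decomposition exists and is unique.\<close>

lemma spread_minmax:
  assumes "set_mset P = {p..<p + s}" "s \<ge> (1::nat)"
  shows "Min_mset P = p" "Max_mset P = p + s - 1"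
proof -
  show "Min_mset P = p" using assms by (intro Min_eqI) auto
  show "Max_mset P = p + s - 1" using assms by (intro Max_eqI) auto
qed

lemma spread_decomp_Nil: "spread_decomp P [] \<longleftrightarrow> P = {#}"
  by (auto simp: spread_decomp_def)

lemma spread_decomp_Cons:
  "spread_decomp P (Q # Qs) \<longleftrightarrow>
     (\<exists>R. P = Q + R \<and> spread Q \<and> spread_decomp R Qs \<and>
        (\<forall>x\<in>#R. Max_mset Q + 2 \<le> x))"
proof (induction Qs arbitrary: P Q)
  case Nil
  then show ?case by (auto simp: spread_decomp_def)
next
  case (Cons Q' Qs)
  have step: "spread_decomp P (Q # Q' # Qs) \<longleftrightarrow>
    (\<exists>R. P = Q + R \<and> spread Q \<and> spread_decomp R (Q' # Qs) \<and>
       Max_mset Q + 2 \<le> Min_mset Q')"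
    by (auto simp: spread_decomp_def)
  have "(Max_mset Q + 2 \<le> Min_mset Q') \<longleftrightarrow> (\<forall>x\<in>#R. Max_mset Q + 2 \<le> x)"
    if R: "spread_decomp R (Q' # Qs)" for R
  proof -
    from R Cons.IH obtain R' where R': "R = Q' + R'" "spread Q'"
      "\<forall>x\<in>#R'. Max_mset Q' + 2 \<le> x" by blast
    then obtain p s where ps: "s \<ge> 1" "set_mset Q' = {p..<p + s}" by (auto simp: spread_def)
    have mm: "Min_mset Q' = p" "Max_mset Q' = p + s - 1"
      using spread_minmax ps by blast+
    have "p \<in># R" using ps R' by auto
    moreover have "p \<le> x" if "x \<in># R" for x using that ps R' mm by fastforce
    ultimately show ?thesis using mm by (metis order_trans)
  qed
  then show ?case using step by blast
qed

lemma spread_decomp_Cons_determined: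
  assumes "spread_decomp P (Q # Qs)" "spread_decomp P (Q' # Qs')"
  shows "Q = Q' \<and> (\<exists>R. size R < size P \<and> spread_decomp R Qs \<and> spread_decomp R Qs')"
proof -
  obtain R where R: "P = Q + R" "spread Q" "spread_decomp R Qs"
    "\<forall>x\<in>#R. Max_mset Q + 2 \<le> x" using assms(1) spread_decomp_Cons by blast
  obtain R' where R': "P = Q' + R'" "spread Q'" "spread_decomp R' Qs'"
    "\<forall>x\<in>#R'. Max_mset Q' + 2 \<le> x" using assms(2) spread_decomp_Cons by blast
  obtain p s where ps: "s \<ge> 1" "set_mset Q = {p..<p + s}" using R(2) by (auto simp: spread_def)
  obtain p' s' where ps': "s' \<ge> 1" "set_mset Q' = {p'..<p' + s'}"
    using R'(2) by (auto simp: spread_def)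
  have mm: "Max_mset Q = p + s - 1" "Max_mset Q' = p' + s' - 1"
    using spread_minmax ps ps' by blast+
  have S: "x \<in># P \<longleftrightarrow> p \<le> x \<and> x < p + s \<or> x \<in># R" for x using R ps by auto
  have S': "x \<in># P \<longleftrightarrow> p' \<le> x \<and> x < p' + s' \<or> x \<in># R'" for x using R' ps' by auto
  have g: "p + s + 1 \<le> x" if "x \<in># R" for x using R(4) that mm ps by fastforce
  have g': "p' + s' + 1 \<le> x" if "x \<in># R'" for x using R'(4) that mm ps' by fastforce
  have "p \<in># P" "p' \<in># P" using S[of p] S'[of p'] ps ps' by auto
  then have "p = p'" using S'[of p] S[of p'] g[of p'] g'[of p] by linarith
  moreover have "p + s \<notin># P" "p' + s' \<notin># P"
    using S[of "p + s"] S'[of "p' + s'"] g[of "p + s"] g'[of "p' + s'"] by linarith+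
  then have "\<not> p + s < p' + s'" "\<not> p' + s' < p + s"
    using S[of "p' + s'"] S'[of "p + s"] \<open>p = p'\<close> by linarith+
  then have "p + s = p' + s'" by linarith
  ultimately have eq: "p = p'" "s = s'" by auto
  have "Q = filter_mset (\<lambda>x. x < p + s) P"
  proof -
    have "filter_mset (\<lambda>x. x < p + s) Q = Q" using ps by (auto simp: filter_mset_eq_conv)
    moreover have "filter_mset (\<lambda>x. x < p + s) R = {#}" using g by (fastforce simp: filter_mset_eq_conv)
    ultimately show ?thesis using R by simp
  qed
  moreover have "Q' = filter_mset (\<lambda>x. x < p + s) P"
  proof -
    have "filter_mset (\<lambda>x. x < p + s) Q' = Q'" using ps' eq by (auto simp: filter_mset_eq_conv)
    moreover have "filter_mset (\<lambda>x. x < p + s) R' = {#}"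
      using g' eq by (fastforce simp: filter_mset_eq_conv)
    ultimately show ?thesis using R' by simp
  qed
  ultimately have "Q = Q'" by simp
  then have "R = R'" using R R' by simp
  moreover have "Q \<noteq> {#}" using ps by auto
  ultimately have "size R < size P" using R by (simp add: nonempty_has_size)
  then show ?thesis using R R' \<open>Q = Q'\<close> \<open>R = R'\<close> by blast
qed

lemma spread_decomp_unique:
  "spread_decomp P Ps \<Longrightarrow> spread_decomp P Ps' \<Longrightarrow> Ps = Ps'"
proof (induction Ps arbitrary: P Ps')
  case Nil
  then have "P = {#}" by (simp add: spread_decomp_Nil)
  then show ?case using Nil(2) by (cases Ps') (auto simp: spread_decomp_Cons spread_def)
next
  case (Cons Q Qs)
  show ?case
  proof (cases Ps')
    case Nil
    then have "P = {#}" using Cons(3) by (simp add: spread_decomp_Nil)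
    then show ?thesis using Cons(2) by (auto simp: spread_decomp_Cons spread_def)
  next
    case (Cons Q' Qs')
    then show ?thesis
      using spread_decomp_Cons_determined[of P Q Qs Q' Qs'] Cons.prems Cons.IH by blast
  qed
qed

lemma spread_decomp_exists: "0 \<notin># P \<Longrightarrow> \<exists>Ps. spread_decomp P Ps"
proof (induction "size P" arbitrary: P rule: less_induct)
  case less
  show ?case
  proof (cases "P = {#}")
    case True
    then show ?thesis using spread_decomp_Nil by blast
  next
    case False
    define p where "p = Min_mset P"
    have p: "p \<in># P" "\<And>x. x \<in># P \<Longrightarrow> p \<le> x" using False by (auto simp: p_def)
    have "\<exists>s. p + s \<notin># P"
    proof -
      have "p + (Max_mset P + 1) \<notin># P"
        using Max_ge[of "set_mset P" "p + (Max_mset P + 1)"]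
        by (metis Suc_eq_plus1 finite_set_mset le_add2 not_less_eq_eq order_trans add_Suc_right)
      then show ?thesis by blast
    qed
    then have s: "p + (LEAST s. p + s \<notin># P) \<notin># P" by (rule LeastI_ex)
    define s where "s = (LEAST s. p + s \<notin># P)"
    have below: "p + t \<in># P" if "t < s" for t using not_less_Least that s_def by blast
    have "s \<noteq> 0" using s p s_def by (metis add_0_right)
    define Q where "Q = filter_mset (\<lambda>x. x < p + s) P"
    define R where "R = filter_mset (\<lambda>x. \<not> x < p + s) P"
    have PQR: "P = Q + R" by (simp add: Q_def R_def)
    have setQ: "set_mset Q = {p..<p + s}"
    proof -
      have "x \<in># P" if "p \<le> x" "x < p + s" for x using below[of "x - p"] that by auto
      then show ?thesis using p by (auto simp: Q_def)
    qed
    have "p \<ge> 1" using p(1) less.prems by (cases p) auto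
    then have spQ: "spread Q" using setQ \<open>s \<noteq> 0\<close> unfolding spread_def
      by (metis One_nat_def Suc_leI not_gr_zero)
    have "Q \<noteq> {#}" using setQ \<open>s \<noteq> 0\<close> by auto
    then have "size R < size P" using PQR by (simp add: nonempty_has_size)
    moreover have "0 \<notin># R" using less.prems by (simp add: R_def)
    ultimately obtain Qs where Qs: "spread_decomp R Qs" using less.hyps by blast
    have mx: "Max_mset Q = p + s - 1" using spread_minmax(2)[OF setQ] \<open>s \<noteq> 0\<close> by simp
    have "Max_mset Q + 2 \<le> x" if "x \<in># R" for x
    proof -
      have "x \<noteq> p + s" using that s by (auto simp: R_def s_def)
      then have "p + s < x" using that by (auto simp: R_def)
      then show ?thesis using mx \<open>s \<noteq> 0\<close> by auto
    qed
    then have "spread_decomp P (Q # Qs)" using PQR spQ Qs spread_decomp_Cons by blast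
    then show ?thesis by blast
  qed
qed

lemma spread_decomp_ex1: "is_partition P n \<Longrightarrow> \<exists>!Ps. spread_decomp P Ps"
  using spread_decomp_exists spread_decomp_unique by (auto simp: is_partition_def)

end

theory Submission
  imports Defs
begin

text \<open>For \<open>p \<noteq> q\<close> one has \<open>(u, p, k) \<le> (v, q, l)\<close> iff \<open>u \<le> v\<close> and \<open>q - v \<le> p - u\<close>, while each row is a
  chain. Let \<open>r\<close> be the number of rows obtained by taking every other row of each spread. The whole
  poset is covered by \<open>r\<close> chains, each made of two consecutive rows and the outermost remaining elements
  of all rows above them. If the row of the \<open>(2 i - 1)\<close>-st and that of the \<open>2 j\<close>-th part of a spread are
  not to be covered completely, the rows in between can be paired differently, so that \<open>r - 1\<close> chains
  suffice to cover all but as many elements as the corresponding term of \<open>\<mu>(P)\<close>. Conversely there are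
  \<open>\<mu>(P)\<close> disjoint antichains of size \<open>r\<close>, each of which is missed at least once by any \<open>r - 1\<close> chains.
  Hence \<open>\<lambda>\<^sub>r = \<mu>(P)\<close>, and \<open>\<lambda>\<close> is non-increasing by an exchange argument on chain families.\<close>

section \<open>Concavity of the size of chain families\<close>

text \<open>Exchange along an alternating path: such a path starting in \<open>Domain M - Domain N\<close> follows the partial
  injection \<open>h\<close>, and \<open>M\<close> being larger, some path does not end in \<open>Domain N - Domain M\<close>.\<close>

lemma swap_partial_injections:
  fixes M N :: "('a \<times> 'b) set"
  assumes fin: "finite M" "finite N" and lt: "card N < card M"
    and M: "single_valued M" "single_valued (M\<inverse>)"
    and N: "single_valued N" "single_valued (N\<inverse>)"
  obtains M' N' where "single_valued M'" "single_valued (M'\<inverse>)"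
    "single_valued N'" "single_valued (N'\<inverse>)"
    "M' \<union> N' = M \<union> N" "M' \<inter> N' = M \<inter> N"
    "card M' + 1 = card M" "card N' = card N + 1"
proof -
  \<comment> \<open>\<open>h\<close> sends \<open>a\<close> to the element whose
    \<open>N\<close>-target is the \<open>M\<close>-target of \<open>a\<close>; following it
    alternates between pairs of \<open>M\<close> and of \<open>N\<close>.\<close>
  define h where "h = {(a, b). \<exists>y. (a, y) \<in> M \<and> (b, y) \<in> N}"
  have h_inj: "single_valued (h\<inverse>)"
    using M N unfolding h_def single_valued_def by blast
  have cd: "card (Domain A) = card A" if "single_valued A" for A :: "('a \<times> 'b) set"
  proof -
    have "inj_on fst A" using that by (auto simp: inj_on_def single_valued_def)
    then show ?thesis by (simp add: Domain_fst card_image)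
  qed
  let ?X = "Domain M - Domain N" and ?Y = "Domain N - Domain M"
  have finD: "finite (Domain M)" "finite (Domain N)" using fin by (simp_all add: finite_Domain)
  have "card ?Y < card ?X"
  proof -
    have "card ?Y + card (Domain M \<inter> Domain N) = card N"
      using card_Diff_subset_Int[of "Domain N" "Domain M"] finD cd[OF N(1)]
      by (metis Int_commute card_Int_Diff add.commute)
    moreover have "card ?X + card (Domain M \<inter> Domain N) = card M"
      using finD cd[OF M(1)] by (metis card_Int_Diff add.commute)
    ultimately show ?thesis using lt by linarith
  qed
  have no_pred: "a = b" if "(a, b) \<in> h\<^sup>*" "b \<notin> Domain N" for a b
    using that(1) by (cases rule: rtranclE) (use that(2) in \<open>auto simp: h_def\<close>)
  have "\<exists>x\<in>?X. h\<^sup>* `` {x} \<inter> ?Y = {}"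
  proof (rule ccontr)
    assume "\<not> ?thesis"
    then have "\<forall>x\<in>?X. \<exists>y. (x, y) \<in> h\<^sup>* \<and> y \<in> ?Y" by blast
    then obtain f where f: "\<And>x. x \<in> ?X \<Longrightarrow> (x, f x) \<in> h\<^sup>* \<and> f x \<in> ?Y" by metis
    \<comment> \<open>Backwards \<open>h\<close> is deterministic, so of two starts with a common
      endpoint one lies on the path of the other; but points outside \<open>Domain N\<close> have no
      predecessor.\<close>
    have "inj_on f ?X"
    proof (rule inj_onI)
      fix x x' assume x: "x \<in> ?X" "x' \<in> ?X" "f x = f x'"
      then have "(f x, x) \<in> (h\<inverse>)\<^sup>*" "(f x, x') \<in> (h\<inverse>)\<^sup>*"
        using f by (metis rtrancl_converseI)+
      then have "(x, x') \<in> (h\<inverse>)\<^sup>* \<or> (x', x) \<in> (h\<inverse>)\<^sup>*"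
        using single_valued_confluent[OF h_inj] by blast
      then have "(x, x') \<in> h\<^sup>* \<or> (x', x) \<in> h\<^sup>*" by (metis rtrancl_converseD)
      then show "x = x'" using x no_pred by blast
    qed
    then have "card ?X \<le> card ?Y" using f finD by (intro card_inj_on_le[of f]) auto
    then show False using \<open>card ?Y < card ?X\<close> by simp
  qed
  then obtain x where x: "x \<in> Domain M" "x \<notin> Domain N" "h\<^sup>* `` {x} \<inter> ?Y = {}" by blast
  define K where "K = h\<^sup>* `` {x}"
  have K_succ: "b \<in> K" if "a \<in> K" "(a, y) \<in> M" "(b, y) \<in> N" for a b y
    using that unfolding K_def h_def by (auto intro: rtrancl_into_rtrancl)
  have K_step: "a = x \<or> (\<exists>c\<in>K. (c, a) \<in> h)" if "a \<in> K" for a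
  proof -
    have "(x, a) \<in> h\<^sup>*" using that by (simp add: K_def)
    then show ?thesis by (cases rule: rtranclE) (auto simp: K_def)
  qed
  have K_pred: "b \<in> K" if a: "a \<in> K" "(a, y) \<in> N" "(b, y) \<in> M" for a b y
  proof -
    have "(b, a) \<in> h" using that by (auto simp: h_def)
    moreover have "a \<noteq> x" using that x by auto
    ultimately show ?thesis using K_step[OF a(1)] h_inj by (auto simp: single_valued_def)
  qed
  \<comment> \<open>All points of the path except \<open>x\<close> lie in \<open>Domain N\<close>,
    and all lie in \<open>Domain M\<close> because the path avoids \<open>?Y\<close>. So
    \<open>M\<close> has exactly one pair more than \<open>N\<close> over \<open>K\<close>, and
    these two parts are exchanged.\<close>
  have KN: "K \<inter> Domain N = K - {x}"
  proof -
    have "a \<in> Domain N" if "a \<in> K" "a \<noteq> x" for a using K_step[OF that(1)] that(2) by (auto simp: h_def)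
    then show ?thesis using x by auto
  qed
  then have KM: "K \<subseteq> Domain M" using x unfolding K_def by blast
  then have finK: "finite K" using finD finite_subset by blast
  have xK: "x \<in> K" by (simp add: K_def)
  define MK where "MK = {e \<in> M. fst e \<in> K}"
  define NK where "NK = {e \<in> N. fst e \<in> K}"
  have "Domain MK = K \<inter> Domain M" "Domain NK = K \<inter> Domain N"
    by (auto simp: MK_def NK_def Domain_iff)
  then have "Domain MK = K" "Domain NK = K - {x}" using KM KN by (simp_all add: inf.absorb1)
  moreover have "single_valued MK" "single_valued NK"
    using M N unfolding MK_def NK_def single_valued_def by blast+
  ultimately have cK: "card MK = card NK + 1"
    using cd finK xK by (metis Suc_eq_plus1 card_Suc_Diff1)
  have sub: "MK \<subseteq> M" "NK \<subseteq> N" by (auto simp: MK_def NK_def)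
  have finK': "finite MK" "finite NK" using sub fin finite_subset by blast+
  have inv_Un: "single_valued ((A \<union> B)\<inverse>)"
    if "single_valued (A\<inverse>)" "single_valued (B\<inverse>)" "\<And>a b y. (a, y) \<in> A \<Longrightarrow> (b, y) \<notin> B"
    for A B :: "('a \<times> 'b) set"
    using that unfolding single_valued_def by blast
  have inv: "single_valued ((M - MK)\<inverse>)" "single_valued (MK\<inverse>)"
    "single_valued ((N - NK)\<inverse>)" "single_valued (NK\<inverse>)"
    using M(2) N(2) sub by (blast intro: single_valued_subset)+
  \<comment> \<open>Pairs of \<open>M\<close> and \<open>N\<close> with a common target start both
    inside \<open>K\<close> or both outside, so the exchange creates no collision of
    targets.\<close>
  have disj: "(a, y) \<in> M - MK \<Longrightarrow> (b, y) \<notin> NK" "(a, y) \<in> N - NK \<Longrightarrow> (b, y) \<notin> MK" for a b y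
    using K_pred[of b y a] K_succ[of b y a] by (auto simp: MK_def NK_def)
  show ?thesis
  proof (rule that[of "(M - MK) \<union> NK" "(N - NK) \<union> MK"])
    show "single_valued (M - MK \<union> NK)" "single_valued (N - NK \<union> MK)"
      using M N unfolding MK_def NK_def single_valued_def by auto
    show "single_valued ((M - MK \<union> NK)\<inverse>)" "single_valued ((N - NK \<union> MK)\<inverse>)"
      by (rule inv_Un[OF inv(1) inv(4)], erule disj) (rule inv_Un[OF inv(3) inv(2)], erule disj)
    show "M - MK \<union> NK \<union> (N - NK \<union> MK) = M \<union> N" using sub by blast
    show "(M - MK \<union> NK) \<inter> (N - NK \<union> MK) = M \<inter> N" by (auto simp: MK_def NK_def)
    have "(M - MK) \<inter> NK = {}" "(N - NK) \<inter> MK = {}" by (auto simp: MK_def NK_def)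
    then have "card (M - MK \<union> NK) = card M - card MK + card NK"
      "card (N - NK \<union> MK) = card N - card NK + card MK"
      using fin finK' sub by (simp_all add: card_Un_disjoint card_Diff_subset)
    moreover have "card MK \<le> card M" "card NK \<le> card N" using fin sub by (simp_all add: card_mono)
    ultimately show "card (M - MK \<union> NK) + 1 = card M" "card (N - NK \<union> MK) = card N + 1"
      using cK by linarith+
  qed
qed

text \<open>Remove the greatest element and link the greatest remaining one to it. Diagonal pairs
  are excluded because loops will mark uncovered elements; the inequality admits the empty
  chain.\<close>

lemma chain_successor_relation:
  assumes "finite C" "C \<in> Chains r" "antisym r" "trans r"
  shows "\<exists>M. M \<subseteq> r - Id \<and> M \<subseteq> C \<times> C \<and> single_valued M \<and> single_valued (M\<inverse>) \<and>
    card C \<le> card M + 1"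
  using assms(1,2)
proof (induction "card C" arbitrary: C)
  case 0
  then show ?case by (intro exI[of _ "{}"]) auto
next
  case (Suc n)
  have top: "\<exists>m\<in>B. \<forall>x\<in>B. (x, m) \<in> r" if "finite B" "B \<noteq> {}" "B \<subseteq> C" for B
    using that
  proof (induction B rule: finite_ne_induct)
    case (singleton x)
    then show ?case using Suc.prems(2) by (auto simp: Chains_def)
  next
    case (insert x F)
    then obtain m where m: "m \<in> F" "\<forall>x\<in>F. (x, m) \<in> r" by blast
    have "(x, m) \<in> r \<or> (m, x) \<in> r" "(x, x) \<in> r"
      using insert m Suc.prems(2) by (auto simp: Chains_def)
    then show ?case using m \<open>trans r\<close> by (metis insert_iff transD)
  qed
  obtain m where m: "m \<in> C" "\<forall>x\<in>C. (x, m) \<in> r" using top[of C] Suc by force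
  let ?C = "C - {m}"
  have "?C \<in> Chains r" using Suc.prems(2) by (auto simp: Chains_def)
  then obtain M where M: "M \<subseteq> r - Id" "M \<subseteq> ?C \<times> ?C" "single_valued M"
    "single_valued (M\<inverse>)" "card ?C \<le> card M + 1"
    using Suc.hyps(1)[of ?C] Suc.hyps(2) Suc.prems(1) m by (metis card_Diff_singleton diff_Suc_1 finite_Diff)
  show ?case
  proof (cases "?C = {}")
    case True
    then have "C = {m}" using m by blast
    then show ?thesis by (intro exI[of _ "{}"]) auto
  next
    case False
    then obtain c where c: "c \<in> ?C" "\<forall>x\<in>?C. (x, c) \<in> r" using top[of ?C] Suc.prems by auto
    have "c \<notin> Domain M" using M c \<open>antisym r\<close> by (fastforce simp: antisym_def)
    moreover have "m \<notin> Range M" using M by blast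
    ultimately have sv: "single_valued (insert (c, m) M)" "single_valued ((insert (c, m) M)\<inverse>)"
      using M unfolding single_valued_def by blast+
    have "finite M" using M(2) Suc.prems(1) by (meson finite_Diff finite_SigmaI finite_subset)
    moreover have "(c, m) \<notin> M" using M by blast
    ultimately have "card C \<le> card (insert (c, m) M) + 1"
      using M(5) Suc.prems(1) m by (simp add: card_Diff_singleton)
    moreover have "insert (c, m) M \<subseteq> r - Id" "insert (c, m) M \<subseteq> C \<times> C" using M c m by auto
    ultimately show ?thesis using sv by blast
  qed
qed

text \<open>A family of \<open>k\<close> disjoint chains is encoded by its successor relation together with loops at the
  uncovered elements, a partial injection with at least \<open>card D - k\<close> pairs.\<close>

lemma partial_injection_of_chains:
  assumes po: "partial_order_on D r" and fin: "finite D" and Cs: "set Cs \<subseteq> Chains r"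
  obtains M where "M \<subseteq> r" "single_valued M" "single_valued (M\<inverse>)"
    "card D \<le> card M + length Cs" "{x. (x, x) \<in> M} = D - \<Union>(set Cs)"
proof -
  have r: "refl_on D r" "antisym r" "trans r" "r \<subseteq> D \<times> D"
    using po by (auto simp: partial_order_on_def preorder_on_def)
  have "\<exists>M. M \<subseteq> r - Id \<and> M \<subseteq> \<Union>(set Cs) \<times> \<Union>(set Cs) \<and> single_valued M \<and> single_valued (M\<inverse>) \<and>
    card (\<Union>(set Cs)) \<le> card M + length Cs"
    using Cs
  proof (induction Cs)
    case Nil
    then show ?case by (intro exI[of _ "{}"]) auto
  next
    case (Cons C Cs)
    let ?S = "\<Union>(set Cs)"
    obtain M where M: "M \<subseteq> r - Id" "M \<subseteq> ?S \<times> ?S" "single_valued M" "single_valued (M\<inverse>)"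
      "card ?S \<le> card M + length Cs" using Cons by auto
    have "B \<subseteq> D" if "B \<in> Chains r" for B using that r(4) by (auto simp: Chains_def)
    then have sub: "C \<subseteq> D" "?S \<subseteq> D" using Cons.prems by auto
    have "C - ?S \<in> Chains r" using Cons.prems by (auto simp: Chains_def)
    then obtain M' where M': "M' \<subseteq> r - Id" "M' \<subseteq> (C - ?S) \<times> (C - ?S)" "single_valued M'"
      "single_valued (M'\<inverse>)" "card (C - ?S) \<le> card M' + 1"
      using chain_successor_relation[of "C - ?S" r] r sub fin by (metis finite_Diff finite_subset)
    have finM: "finite M" "finite M'"
      using M(1) M'(1) r(4) fin by (meson Diff_subset finite_SigmaI finite_subset)+
    have "M \<inter> M' = {}" using M(2) M'(2) by blast
    then have "card (M \<union> M') = card M + card M'" using finM by (simp add: card_Un_disjoint)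
    moreover have "card (C \<union> ?S) = card (C - ?S) + card ?S"
      using sub fin by (metis Un_Diff_cancel2 card_Un_disjoint Diff_disjoint finite_Diff finite_subset inf_commute)
    ultimately have "card (\<Union>(set (C # Cs))) \<le> card (M \<union> M') + length (C # Cs)"
      using M(5) M'(5) by simp
    moreover have "single_valued (M \<union> M')" "single_valued ((M \<union> M')\<inverse>)"
      using M(2,3,4) M'(2,3,4) unfolding single_valued_def by blast+
    moreover have "M \<union> M' \<subseteq> r - Id" using M(1) M'(1) by blast
    moreover have "M \<union> M' \<subseteq> \<Union>(set (C # Cs)) \<times> \<Union>(set (C # Cs))" using M(2) M'(2) by auto
    ultimately show ?case by blast
  qed
  then obtain M where M: "M \<subseteq> r - Id" "M \<subseteq> \<Union>(set Cs) \<times> \<Union>(set Cs)" "single_valued M"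
    "single_valued (M\<inverse>)" "card (\<Union>(set Cs)) \<le> card M + length Cs" by blast
  let ?S = "\<Union>(set Cs)"
  have S: "?S \<subseteq> D" using Cs r(4) by (auto simp: Chains_def)
  have finM: "finite M" using M(1) r(4) fin by (meson Diff_subset finite_SigmaI finite_subset)
  show ?thesis
  proof (rule that[of "M \<union> Id_on (D - ?S)"])
    show "M \<union> Id_on (D - ?S) \<subseteq> r" using M(1) r(1) by (auto simp: refl_on_def)
    show "single_valued (M \<union> Id_on (D - ?S))" "single_valued ((M \<union> Id_on (D - ?S))\<inverse>)"
      using M(2,3,4) unfolding single_valued_def by blast+
    have "card (Id_on (D - ?S)) = card (D - ?S)"
      by (simp add: Id_on_def UNION_singleton_eq_range card_image inj_on_def)
    moreover have "M \<inter> Id_on (D - ?S) = {}" using M(2) by blast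
    ultimately have "card (M \<union> Id_on (D - ?S)) = card M + card (D - ?S)"
      using finM fin by (subst card_Un_disjoint) (auto simp: Id_on_def)
    moreover have "card D = card ?S + card (D - ?S)"
      using S fin by (metis card_Diff_subset card_mono finite_subset le_add_diff_inverse)
    ultimately show "card D \<le> card (M \<union> Id_on (D - ?S)) + length Cs" using M(5) by simp
    show "{x. (x, x) \<in> M \<union> Id_on (D - ?S)} = D - ?S" using M(1) by auto
  qed
qed

text \<open>Converse of the encoding: the chains are the maximal paths of off-diagonal pairs. A
  partial injection has no second pair at a loop, so the paths avoid the loops, and their number is
  \<open>card D - card M\<close>.\<close>

lemma chains_of_partial_injection:
  assumes po: "partial_order_on D r" and fin: "finite D"
    and M: "M \<subseteq> r" "single_valued M" "single_valued (M\<inverse>)" "card D \<le> card M + k"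
  obtains Cs where "set Cs \<subseteq> Chains r" "length Cs = k" "card D \<le> card (\<Union>(set Cs)) + card {x. (x, x) \<in> M}"
proof -
  have r: "refl_on D r" "antisym r" "trans r" "r \<subseteq> D \<times> D"
    using po by (auto simp: partial_order_on_def preorder_on_def)
  define L where "L = {x. (x, x) \<in> M}"
  define N where "N = M - Id"
  have L: "L \<subseteq> D" using M(1) r(4) by (auto simp: L_def)
  have finM: "finite M" using M(1) r(4) fin by (meson finite_SigmaI finite_subset)
  have N: "N \<subseteq> (D - L) \<times> (D - L)"
    using M(1,2,3) r(4) unfolding N_def L_def single_valued_def by blast
  have svN: "single_valued N" "single_valued (N\<inverse>)" using M by (auto simp: N_def single_valued_def)
  have cN: "card N + card L = card M"
  proof -
    have "M = N \<union> Id_on L" by (auto simp: N_def L_def)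
    moreover have "N \<inter> Id_on L = {}" by (auto simp: N_def)
    moreover have "card (Id_on L) = card L"
      by (simp add: Id_on_def UNION_singleton_eq_range card_image inj_on_def)
    ultimately show ?thesis using finM by (metis card_Un_disjoint finite_Un)
  qed
  define T where "T = D - L - Range N"
  have "inj_on snd N" using svN(2) by (auto simp: inj_on_def single_valued_def)
  then have "card (Range N) = card N" by (simp add: Range_snd card_image)
  moreover have "Range N \<subseteq> D - L" using N by blast
  ultimately have "card T + card N = card (D - L)"
    unfolding T_def using fin
    by (metis card_Diff_subset card_mono finite_Diff finite_subset le_add_diff_inverse2)
  moreover have "card (D - L) + card L = card D"
    using L fin by (metis card_Diff_subset card_mono finite_subset le_add_diff_inverse2)
  ultimately have cT: "card T \<le> k" using cN M(4) by linarith
  have reach: "(x, y) \<in> r" if "(x, y) \<in> N\<^sup>*" "x \<in> D" for x y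
    using that(1)
  proof induction
    case base
    then show ?case using r(1) that(2) by (simp add: refl_on_def)
  next
    case (step y z)
    then show ?case using M(1) r(3) by (auto simp: N_def dest: transD)
  qed
  have chain: "N\<^sup>* `` {x} \<in> Chains r" if "x \<in> T" for x
  proof -
    have "(a, b) \<in> r \<or> (b, a) \<in> r" if "(x, a) \<in> N\<^sup>*" "(x, b) \<in> N\<^sup>*" for a b
    proof -
      have "x \<in> D" using \<open>x \<in> T\<close> by (simp add: T_def)
      then have "a \<in> D" "b \<in> D" using that reach r(4) by blast+
      then show ?thesis using single_valued_confluent[OF svN(1) that] reach by blast
    qed
    then show ?thesis by (auto simp: Chains_def)
  qed
  have "N\<^sup>+ \<subseteq> r - Id"
  proof -
    have "(x, y) \<in> r - Id" if "(x, y) \<in> N\<^sup>+" for x y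
      using that
    proof induction
      case (base y)
      then show ?case using M(1) by (auto simp: N_def)
    next
      case (step y z)
      then have "(y, z) \<in> r - Id" using M(1) by (auto simp: N_def)
      then show ?case using step.IH r(2,3) by (auto dest: transD antisymD)
    qed
    then show ?thesis by auto
  qed
  \<comment> \<open>The order excludes cycles, so going back along \<open>N\<close> from any element
    without a loop ends in \<open>T\<close>.\<close>
  then have "acyclic N" by (auto simp: acyclic_def)
  then have "wf N" using finM by (intro finite_acyclic_wf) (auto simp: N_def)
  have cover: "y \<in> D - L \<Longrightarrow> \<exists>x\<in>T. (x, y) \<in> N\<^sup>*" for y
    using \<open>wf N\<close>
  proof (induction y rule: wf_induct_rule)
    case (less y)
    show ?case
    proof (cases "y \<in> T")
      case False
      then obtain z where z: "(z, y) \<in> N" using less.prems by (auto simp: T_def)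
      then have "z \<in> D - L" using N by blast
      then show ?thesis using less.IH[OF z] z by (meson rtrancl_into_rtrancl)
    qed auto
  qed
  have finT: "finite T" using fin by (simp add: T_def)
  obtain xs where xs: "set xs = T" "length xs = card T"
    using finT finite_distinct_list distinct_card by metis
  define Cs where "Cs = map (\<lambda>x. N\<^sup>* `` {x}) xs @ replicate (k - card T) {}"
  have "set Cs \<subseteq> Chains r" using chain xs by (auto simp: Cs_def Chains_def)
  moreover have "length Cs = k" using xs cT by (simp add: Cs_def)
  moreover have "D - L \<subseteq> \<Union>(set Cs)" using cover xs by (fastforce simp: Cs_def)
  moreover have "\<Union>(set Cs) \<subseteq> D" using \<open>set Cs \<subseteq> Chains r\<close> r(4) by (auto simp: Chains_def)
  ultimately show ?thesis
    using that[of Cs] \<open>card (D - L) + card L = card D\<close> fin L_def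
    by (metis card_mono finite_subset add_le_mono1)
qed

text \<open>Unless the encoding of \<open>Es\<close> already has enough pairs for
  \<open>k + 1\<close> chains, moving one pair from \<open>M\<close> to \<open>N\<close> leaves both
  large enough. The swap preserves union and intersection, hence the total number of loops, which
  bounds what is left uncovered.\<close>

lemma chain_families_exchange:
  assumes po: "partial_order_on D r" and fin: "finite D"
    and Cs: "set Cs \<subseteq> Chains r" "length Cs = k" and Es: "set Es \<subseteq> Chains r" "length Es = k + 2"
  obtains Fs Gs where "set Fs \<subseteq> Chains r" "length Fs = k + 1" "set Gs \<subseteq> Chains r" "length Gs = k + 1"
    "card (\<Union>(set Cs)) + card (\<Union>(set Es)) \<le> card (\<Union>(set Fs)) + card (\<Union>(set Gs))"
proof -
  have rD: "r \<subseteq> D \<times> D" using po by (auto simp: partial_order_on_def preorder_on_def)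
  define lo :: "('a \<times> 'a) set \<Rightarrow> nat" where "lo M = card {x. (x, x) \<in> M}" for M
  obtain M where M: "M \<subseteq> r" "single_valued M" "single_valued (M\<inverse>)"
    "card D \<le> card M + length Cs" "{x. (x, x) \<in> M} = D - \<Union>(set Cs)"
    using partial_injection_of_chains[OF po fin Cs(1)] .
  obtain N where N: "N \<subseteq> r" "single_valued N" "single_valued (N\<inverse>)"
    "card D \<le> card N + length Es" "{x. (x, x) \<in> N} = D - \<Union>(set Es)"
    using partial_injection_of_chains[OF po fin Es(1)] .
  have finMN: "finite M" "finite N" using M(1) N(1) rD fin by (meson finite_SigmaI finite_subset)+
  have "B \<subseteq> D" if "B \<in> Chains r" for B using that rD by (auto simp: Chains_def)
  then have sub: "\<Union>(set Cs) \<subseteq> D" "\<Union>(set Es) \<subseteq> D" using Cs(1) Es(1) by blast+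
  have card_compl: "card (D - S) + card S = card D" if "S \<subseteq> D" for S
    using that fin by (simp add: card_Diff_subset card_mono finite_subset)
  have loMN: "lo M + card (\<Union>(set Cs)) = card D" "lo N + card (\<Union>(set Es)) = card D"
    unfolding lo_def M(5) N(5) using sub card_compl by blast+
  have "\<exists>M' N'. M' \<subseteq> r \<and> single_valued M' \<and> single_valued (M'\<inverse>) \<and> card D \<le> card M' + (k + 1) \<and>
    N' \<subseteq> r \<and> single_valued N' \<and> single_valued (N'\<inverse>) \<and> card D \<le> card N' + (k + 1) \<and>
    lo M' + lo N' = lo M + lo N"
  proof (cases "card D \<le> card N + (k + 1)")
    case True
    then show ?thesis using M N Cs(2) by (intro exI[of _ M] exI[of _ N]) auto
  next
    case False
    then have "card N < card M" using M(4) Cs(2) by linarith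
    obtain M' N' where MN: "single_valued M'" "single_valued (M'\<inverse>)"
      "single_valued N'" "single_valued (N'\<inverse>)"
      "M' \<union> N' = M \<union> N" "M' \<inter> N' = M \<inter> N" "card M' + 1 = card M" "card N' = card N + 1"
      using swap_partial_injections[OF finMN \<open>card N < card M\<close> M(2,3) N(2,3)] .
    have sub': "M' \<subseteq> r" "N' \<subseteq> r" using MN(5) M(1) N(1) by blast+
    have lo_Un: "lo A + lo B = card {x. (x, x) \<in> A \<union> B} + card {x. (x, x) \<in> A \<inter> B}"
      if "A \<subseteq> r" "B \<subseteq> r" for A B
    proof -
      have "finite {x. (x, x) \<in> A}" "finite {x. (x, x) \<in> B}"
        using that rD fin by (auto intro: finite_subset[of _ D])
      then show ?thesis using card_Un_Int[of "{x. (x, x) \<in> A}" "{x. (x, x) \<in> B}"]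
        by (simp add: lo_def Collect_disj_eq Collect_conj_eq)
    qed
    have "lo M' + lo N' = lo M + lo N"
      unfolding lo_Un[OF sub'] lo_Un[OF M(1) N(1)] MN(5,6) ..
    then show ?thesis using MN sub' M(4) N(4) Cs(2) Es(2) by (intro exI[of _ M'] exI[of _ N']) auto
  qed
  then obtain M' N' where *: "M' \<subseteq> r" "single_valued M'" "single_valued (M'\<inverse>)"
    "card D \<le> card M' + (k + 1)" "N' \<subseteq> r" "single_valued N'" "single_valued (N'\<inverse>)"
    "card D \<le> card N' + (k + 1)" "lo M' + lo N' = lo M + lo N" by blast
  obtain Fs where Fs: "set Fs \<subseteq> Chains r" "length Fs = k + 1" "card D \<le> card (\<Union>(set Fs)) + lo M'"
    using chains_of_partial_injection[OF po fin *(1-4)] unfolding lo_def .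
  obtain Gs where Gs: "set Gs \<subseteq> Chains r" "length Gs = k + 1" "card D \<le> card (\<Union>(set Gs)) + lo N'"
    using chains_of_partial_injection[OF po fin *(5-8)] unfolding lo_def .
  show ?thesis by (rule that[OF Fs(1,2) Gs(1,2)]) (use Fs(3) Gs(3) *(9) loMN in linarith)
qed

section \<open>Order, chain covers and antichains\<close>

lemma D_elems_iff: "(u, p, k) \<in> D_elems P \<longleftrightarrow> p \<in># P \<and> 1 \<le> u \<and> u \<le> p \<and> 1 \<le> k \<and> k \<le> count P p"
  unfolding D_elems_def by blast

lemma finite_D_elems: "finite (D_elems P)"
proof -
  have "D_elems P \<subseteq> {..Max_mset P} \<times> set_mset P \<times> {..size P}"
    using Max_ge[of "set_mset P"] count_le_size[of P] by (fastforce simp: D_elems_def intro: order_trans)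
  then show ?thesis by (rule finite_subset) simp
qed

text \<open>No cover lowers \<open>u\<close> or raises the distance \<open>p - u\<close> to the
  right end of the row; the second inequality says this without subtraction.\<close>

lemma D_order_imp:
  assumes "((u, p, k), (v, q, l)) \<in> D_order P"
  shows "u \<le> v \<and> q + u \<le> p + v"
proof -
  have "((u, p, k), (v, q, l)) \<in> (D_cover P)\<^sup>*" using assms by (simp add: D_order_def)
  then show ?thesis
  proof (induction rule: rtrancl_induct[of "(u, p, k)" "(v, q, l)", split_format (complete)])
    case (step v q l w x m)
    from step.hyps(2) show ?case
      using step.IH by cases (auto simp: next_part_def)
  qed auto
qed

lemma D_cover_star_copies:
  assumes "(u, p, k) \<in> D_elems P" "(u, p, l) \<in> D_elems P" "k \<le> l"
  shows "((u, p, k), (u, p, l)) \<in> (D_cover P)\<^sup>*"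
  using assms(3,2)
proof (induction l rule: dec_induct)
  case (step m)
  then have "(u, p, m) \<in> D_elems P" using assms(1) by (auto simp: D_elems_iff)
  moreover from this have "((u, p, m), (u, p, Suc m)) \<in> D_cover P"
    using step.prems by (auto intro: D_cover.e)
  ultimately show ?case using step.IH by (meson rtrancl_into_rtrancl)
qed auto

text \<open>Covers other than \<open>e\<close> leave from the last copy of a vertex and enter at the
  first, so a path between these two copies serves all copies.\<close>

lemma D_cover_star_jump:
  assumes "(u, p, k) \<in> D_elems P" "(v, q, l) \<in> D_elems P"
    "((u, p, count P p), (v, q, 1)) \<in> (D_cover P)\<^sup>*"
  shows "((u, p, k), (v, q, l)) \<in> (D_cover P)\<^sup>*"
proof -
  have "((u, p, k), (u, p, count P p)) \<in> (D_cover P)\<^sup>*"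
    using assms(1) by (intro D_cover_star_copies) (auto simp: D_elems_iff)
  moreover have "((v, q, 1), (v, q, l)) \<in> (D_cover P)\<^sup>*"
    using assms(2) by (intro D_cover_star_copies) (auto simp: D_elems_iff)
  ultimately show ?thesis using assms(3) by (meson rtrancl_trans)
qed

lemma D_cover_star_up:
  assumes "(u, p, k) \<in> D_elems P" "(u + (q - p), q, l) \<in> D_elems P" "p < q"
  shows "((u, p, k), (u + (q - p), q, l)) \<in> (D_cover P)\<^sup>*"
  using assms
proof (induction "q - p" arbitrary: u p k q l rule: less_induct)
  case less
  show ?case
  proof (cases "next_part P p q")
    case True
    then have "((u, p, count P p), (u + (q - p), q, 1)) \<in> D_cover P"
      using less.prems by (intro D_cover.alpha) (auto simp: D_elems_iff)
    then show ?thesis using less.prems D_cover_star_jump by blast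
  next
    case False
    then obtain x where x: "x \<in># P" "p < x" "x < q"
      using less.prems by (auto simp: next_part_def D_elems_iff)
    then have "(u + (x - p), x, 1) \<in> D_elems P" using less.prems by (auto simp: D_elems_iff Suc_le_eq)
    moreover have "u + (x - p) + (q - x) = u + (q - p)" using x by simp
    ultimately have "((u, p, k), (u + (x - p), x, 1)) \<in> (D_cover P)\<^sup>*"
      "((u + (x - p), x, 1), (u + (q - p), q, l)) \<in> (D_cover P)\<^sup>*"
      using less.hyps[of x p u k 1] less.hyps[of q x "u + (x - p)" 1 l] less.prems x by simp_all
    then show ?thesis by (rule rtrancl_trans)
  qed
qed

lemma D_cover_star_down:
  assumes "(u, p, k) \<in> D_elems P" "(u, q, l) \<in> D_elems P" "q < p"
  shows "((u, p, k), (u, q, l)) \<in> (D_cover P)\<^sup>*"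
  using assms
proof (induction "p - q" arbitrary: p k q l rule: less_induct)
  case less
  show ?case
  proof (cases "next_part P q p")
    case True
    then have "((u, p, count P p), (u, q, 1)) \<in> D_cover P"
      using less.prems by (intro D_cover.beta) (auto simp: D_elems_iff)
    then show ?thesis using less.prems D_cover_star_jump by blast
  next
    case False
    then obtain x where x: "x \<in># P" "q < x" "x < p"
      using less.prems by (auto simp: next_part_def D_elems_iff)
    then have "(u, x, 1) \<in> D_elems P" using less.prems by (auto simp: D_elems_iff Suc_le_eq)
    then show ?thesis
      using less.hyps[of p x k 1] less.hyps[of x q 1 l] less.prems x
      by (simp add: diff_less_mono diff_less_mono2 rtrancl_trans)
  qed
qed

text \<open>A step to the right goes up and down through row \<open>p + 1\<close>, or down and up
  through row \<open>p - 1\<close>; if neither is a part, it is the cover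
  \<open>omega\<close>.\<close>

lemma D_cover_star_right1:
  assumes P: "0 \<notin># P" and a: "(u, p, k) \<in> D_elems P" "(Suc u, p, l) \<in> D_elems P"
  shows "((u, p, k), (Suc u, p, l)) \<in> (D_cover P)\<^sup>*"
proof -
  consider "Suc p \<in># P" | "p - 1 \<in># P" | "p + 1 \<notin># P" "p - 1 \<notin># P" by fastforce
  then show ?thesis
  proof cases
    case 1
    then have "(Suc u, Suc p, 1) \<in> D_elems P" using a by (auto simp: D_elems_iff Suc_le_eq)
    then show ?thesis
      using D_cover_star_up[of u p k P "Suc p" 1] D_cover_star_down[of "Suc u" "Suc p" 1 P p l] a
      by (simp add: rtrancl_trans)
  next
    case 2
    then have "p - 1 \<noteq> 0" using P by metis
    then have "(u, p - 1, 1) \<in> D_elems P" using a 2 by (auto simp: D_elems_iff Suc_le_eq)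
    then show ?thesis
      using D_cover_star_down[of u p k P "p - 1" 1] D_cover_star_up[of u "p - 1" 1 P p l] a \<open>p - 1 \<noteq> 0\<close>
      by (simp add: rtrancl_trans)
  next
    case 3
    then have "((u, p, count P p), (Suc u, p, 1)) \<in> D_cover P"
      using a by (intro D_cover.omega) (auto simp: D_elems_iff)
    then show ?thesis using a D_cover_star_jump by blast
  qed
qed

lemma D_cover_star_right:
  assumes P: "0 \<notin># P" and a: "(u, p, k) \<in> D_elems P" "(v, p, l) \<in> D_elems P"
    and le: "u < v \<or> u = v \<and> k \<le> l"
  shows "((u, p, k), (v, p, l)) \<in> (D_cover P)\<^sup>*"
proof (cases "u = v")
  case True
  then show ?thesis using D_cover_star_copies a le by auto
next
  case False
  then have "Suc u \<le> v" using le by auto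
  then show ?thesis using a(2)
  proof (induction v arbitrary: l rule: dec_induct)
    case base
    then show ?case using D_cover_star_right1[OF P a(1)] by blast
  next
    case (step v)
    then have "(v, p, 1) \<in> D_elems P" using a by (auto simp: D_elems_iff)
    then show ?case using step D_cover_star_right1[OF P] by (meson rtrancl_trans)
  qed
qed

lemma D_order_row:
  assumes "0 \<notin># P" "(u, p, k) \<in> D_elems P" "(v, p, l) \<in> D_elems P" "u < v \<or> u = v \<and> k \<le> l"
  shows "((u, p, k), (v, p, l)) \<in> D_order P"
  using D_cover_star_right[OF assms(1,2,3,4)] assms(2,3) unfolding D_order_def by blast

text \<open>The path enters row \<open>q\<close> at the leftmost position above
  \<open>(u, p, k)\<close>, namely \<open>u + (q - p)\<close> or \<open>u\<close>, and then moves
  right.\<close>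

lemma D_order_rows:
  assumes P: "0 \<notin># P" and a: "(u, p, k) \<in> D_elems P" "(v, q, l) \<in> D_elems P" and "p \<noteq> q"
    and le: "u \<le> v" "q + u \<le> p + v"
  shows "((u, p, k), (v, q, l)) \<in> D_order P"
proof -
  have refl: "((w, q, 1), (v, q, l)) \<in> (D_cover P)\<^sup>*" if "(w, q, 1) \<in> D_elems P" "w \<le> v" for w
    using a(2) that(2) by (intro D_cover_star_right[OF P that(1)]) (auto simp: D_elems_iff)
  show ?thesis
  proof (cases "p < q")
    case True
    then have w: "(u + (q - p), q, 1) \<in> D_elems P" using a by (auto simp: D_elems_iff Suc_le_eq)
    have "u + (q - p) \<le> v" using le True by simp
    then show ?thesis using rtrancl_trans[OF D_cover_star_up[OF a(1) w True] refl[OF w]] a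
      by (simp add: D_order_def)
  next
    case False
    then have "q < p" using \<open>p \<noteq> q\<close> by simp
    have w: "(u, q, 1) \<in> D_elems P" using a le by (auto simp: D_elems_iff Suc_le_eq)
    show ?thesis using rtrancl_trans[OF D_cover_star_down[OF a(1) w \<open>q < p\<close>] refl[OF w le(1)]] a
      by (simp add: D_order_def)
  qed
qed

section \<open>Chain covers from a grouping of the rows\<close>

text \<open>The rows \<open>q\<close> with \<open>keep q\<close> and \<open>\<gamma> q = t\<close> form an almost rectangular group. The \<open>t\<close>-th chain consists
  of that group from depth \<open>t\<close> on and of the elements at depth \<open>t\<close> in all rows above it, where the depth of an element is
  its distance to the nearer end of its row.\<close>

lemma chain_coverI:
  fixes \<gamma> :: "nat \<Rightarrow> nat" and keep :: "nat \<Rightarrow> bool"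
  assumes P: "0 \<notin># P"
    and mono: "\<And>q q'. q \<in># P \<Longrightarrow> q' \<in># P \<Longrightarrow> q \<le> q' \<Longrightarrow> \<gamma> q \<le> \<gamma> q'"
    and adj: "\<And>q q'. q \<in># P \<Longrightarrow> q' \<in># P \<Longrightarrow> keep q \<Longrightarrow> keep q' \<Longrightarrow> q < q' \<Longrightarrow> \<gamma> q = \<gamma> q' \<Longrightarrow> q' = Suc q"
    and le: "\<And>q. q \<in># P \<Longrightarrow> \<gamma> q \<le> m"
    and less: "\<And>q. q \<in># P \<Longrightarrow> keep q \<Longrightarrow> \<gamma> q < m"
  obtains Cs where "set Cs \<subseteq> Chains (D_order P)" "length Cs = m"
    "D_elems P - \<Union>(set Cs) \<subseteq> {(u, q, k) \<in> D_elems P. \<not> keep q \<and> \<gamma> q < u \<and> u + \<gamma> q \<le> q}"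
proof -
  define d :: "nat \<Rightarrow> nat \<Rightarrow> nat" where "d u q = min (u - 1) (q - u)" for u q
  define C where "C t = {(u, q, k) \<in> D_elems P. d u q = t \<and> t < \<gamma> q \<or> keep q \<and> \<gamma> q = t \<and> t \<le> d u q}" for t
  have chain: "C t \<in> Chains (D_order P)" for t
  proof -
    have main: "((u, p, k), (v, q, l)) \<in> D_order P \<or> ((v, q, l), (u, p, k)) \<in> D_order P"
      if a: "(u, p, k) \<in> C t" "(v, q, l) \<in> C t" and "p \<le> q" for u p k v q l
    proof (cases "p = q")
      case True
      then have "(u, p, k) \<in> D_elems P" "(v, p, l) \<in> D_elems P" using a by (auto simp: C_def)
      then show ?thesis using D_order_row[OF P] True by (metis linorder_neqE_nat nat_le_linear)
    next
      case False
      then have "p < q" using \<open>p \<le> q\<close> by simp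
      have D: "(u, p, k) \<in> D_elems P" "(v, q, l) \<in> D_elems P" using a by (auto simp: C_def)
      then have D': "p \<in># P" "1 \<le> u" "u \<le> p" "q \<in># P" "1 \<le> v" "v \<le> q" by (auto simp: D_elems_iff)
      have tp: "t \<le> d u p" and tq: "d v q = t \<and> t < \<gamma> q \<or> keep q \<and> \<gamma> q = t \<and> t \<le> d v q"
        using a by (auto simp: C_def)
      \<comment> \<open>An element of depth exactly \<open>t\<close> in the longer row is at
        distance \<open>t\<close> from one end; the other element is at least as far from the same
        end, which makes the two comparable.\<close>
      have "u \<le> v \<and> q + u \<le> p + v \<or> v \<le> u \<and> p + v \<le> q + u"
      proof (cases "d v q = t")
        case True
        then show ?thesis using tp D' \<open>p < q\<close> by (auto simp: d_def min_def split: if_splits)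
      next
        case neq: False
        \<comment> \<open>Otherwise both rows are kept in group \<open>t\<close>, and any two
          elements of rows of lengths \<open>p\<close> and \<open>p + 1\<close> are
          comparable.\<close>
        then have q: "keep q" "\<gamma> q = t" using tq by auto
        then have "\<gamma> p \<le> t" using mono[of p q] D' \<open>p < q\<close> by auto
        then have "keep p" "\<gamma> p = t" using a by (auto simp: C_def)
        then have "q = Suc p" using adj q D' \<open>p < q\<close> by auto
        then show ?thesis by linarith
      qed
      then show ?thesis using D_order_rows[OF P D False] D_order_rows[OF P D(2,1)] False by auto
    qed
    then have "(x, y) \<in> D_order P \<or> (y, x) \<in> D_order P" if "x \<in> C t" "y \<in> C t" for x y
      using that by (cases x; cases y) (metis nat_le_linear)
    then show ?thesis by (auto simp: Chains_def)
  qed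
  show ?thesis
  proof (rule that[of "map C [0..<m]"])
    show "set (map C [0..<m]) \<subseteq> Chains (D_order P)" using chain by auto
    show "D_elems P - \<Union>(set (map C [0..<m])) \<subseteq>
      {(u, q, k) \<in> D_elems P. \<not> keep q \<and> \<gamma> q < u \<and> u + \<gamma> q \<le> q}"
    proof clarify
      fix u q k assume a: "(u, q, k) \<in> D_elems P" "(u, q, k) \<notin> \<Union>(set (map C [0..<m]))"
      then have n: "(u, q, k) \<notin> C t" if "t < m" for t using that by auto
      have q: "q \<in># P" "1 \<le> u" "u \<le> q" using a(1) by (auto simp: D_elems_iff)
      \<comment> \<open>At smaller depth the element would lie in the chain of that depth, which
        exists as \<open>\<gamma> q \<le> m\<close>. In a kept row the rest lies in chain
        \<open>\<gamma> q\<close>, which exists as \<open>\<gamma> q < m\<close>.\<close>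
      have "\<gamma> q \<le> d u q" using n[of "d u q"] a(1) le[OF q(1)] by (fastforce simp: C_def)
      moreover from this have "\<not> keep q" using n[of "\<gamma> q"] a(1) less[OF q(1)] by (auto simp: C_def)
      ultimately show "\<not> keep q \<and> \<gamma> q < u \<and> u + \<gamma> q \<le> q" using q by (auto simp: d_def)
    qed
  qed simp
qed

lemma card_uncovered_row:
  "card {(u, q', k) \<in> D_elems P. q' = q \<and> g < u \<and> u + g \<le> q} \<le> (q - 2 * g) * count P q"
proof -
  have "{(u, q', k) \<in> D_elems P. q' = q \<and> g < u \<and> u + g \<le> q} \<subseteq>
    (\<lambda>(u, k). (u, q, k)) ` ({g<..q - g} \<times> {1..count P q})"
    by (auto simp: D_elems_iff image_iff)
  then have "card {(u, q', k) \<in> D_elems P. q' = q \<and> g < u \<and> u + g \<le> q} \<le> card ({g<..q - g} \<times> {1..count P q})"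
    by (meson card_image_le card_mono finite_SigmaI finite_atLeastAtMost finite_greaterThanAtMost
        finite_imageI le_trans)
  then show ?thesis by (simp add: mult_2)
qed

section \<open>Disjoint antichains\<close>

text \<open>The \<open>t\<close>-th antichain meets one of the rows \<open>w \<rho> + 2 * \<rho>\<close> and \<open>w \<rho> + 2 * \<rho> + 1\<close> for every rank
  \<open>\<rho> < r\<close>. Lay out the interval from \<open>0\<close> to \<open>M\<close> as alternating blocks of lengths \<open>\<beta> \<rho>\<close> (upper row) and
  \<open>(M - \<beta> \<rho>) / w \<rho> - \<beta> \<rho>\<close> (lower row); the block containing \<open>t\<close> is the vertex used, and \<open>a t \<rho>\<close>, \<open>b t \<rho>\<close>
  count the lower blocks to its left and to its right. Both grow with \<open>\<rho>\<close> because the period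
  \<open>(M - \<beta> \<rho>) / w \<rho>\<close> decreases, and this says that the chosen elements are incomparable.
  All positions are multiplied by \<open>w \<rho>\<close> to stay in the integers.\<close>

lemma antichains_bound:
  fixes w \<beta> :: "nat \<Rightarrow> nat" and M r :: nat
  assumes w: "\<And>\<rho>. \<rho> < r \<Longrightarrow> 1 \<le> w \<rho>"
    and upper: "\<And>\<rho>. \<rho> < r \<Longrightarrow> \<beta> \<rho> \<le> count P (w \<rho> + 2 * \<rho> + 1)"
    and small: "\<And>\<rho>. \<rho> < r \<Longrightarrow> (w \<rho> + 1) * \<beta> \<rho> \<le> M"
    and lower: "\<And>\<rho>. \<rho> < r \<Longrightarrow> M \<le> w \<rho> * count P (w \<rho> + 2 * \<rho>) + (w \<rho> + 1) * \<beta> \<rho>"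
    and w_mono: "\<And>\<rho> \<sigma>. \<rho> < \<sigma> \<Longrightarrow> \<sigma> < r \<Longrightarrow> w \<rho> \<le> w \<sigma>"
    and slope: "\<And>\<rho> \<sigma>. \<rho> < \<sigma> \<Longrightarrow> \<sigma> < r \<Longrightarrow> w \<rho> * (M - \<beta> \<sigma>) \<le> w \<sigma> * (M - \<beta> \<rho>)"
    and Cs: "set Cs \<subseteq> Chains (D_order P)" "length Cs < r"
  shows "M \<le> card (D_elems P - \<Union>(set Cs))"
proof -
  define N where "N \<rho> = M - \<beta> \<rho>" for \<rho>
  \<comment> \<open>Blocks are open on the left and closed on the right: \<open>a\<close> counts the
    lower blocks ending strictly before \<open>t + 1\<close>, hence the \<open>- 1\<close>, and
    \<open>b\<close> those starting at \<open>t + 1\<close> or later.\<close>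
  define a where "a t \<rho> = min (w \<rho>) ((Suc t * w \<rho> - 1) div N \<rho>)" for t \<rho>
  define b where "b t \<rho> = min (w \<rho>) ((M - Suc t) * w \<rho> div N \<rho>)" for t \<rho>
  define off where "off t \<rho> = a t \<rho> * N \<rho> + (if a t \<rho> + b t \<rho> = w \<rho> then 0 else \<beta> \<rho> * w \<rho>)" for t \<rho>
  \<comment> \<open>The chosen vertex has \<open>a + \<rho>\<close> positions to its left and
    \<open>b + \<rho>\<close> to its right in its row. The copy number is the offset of
    \<open>t + 1\<close> in its block, whose scaled start is \<open>off\<close>.\<close>
  define e where "e t \<rho> = (a t \<rho> + \<rho> + 1, a t \<rho> + b t \<rho> + 2 * \<rho> + 1, Suc t - off t \<rho> div w \<rho>)" for t \<rho>
  have N_pos: "0 < N \<rho>" and wN: "w \<rho> * \<beta> \<rho> \<le> N \<rho>" and MN: "M = N \<rho> + \<beta> \<rho>" if "\<rho> < r" "0 < M" for \<rho>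
  proof -
    have "w \<rho> * \<beta> \<rho> + \<beta> \<rho> \<le> M" "\<beta> \<rho> \<le> w \<rho> * \<beta> \<rho>" using small[OF that(1)] w[OF that(1)] by simp_all
    then show "0 < N \<rho>" "w \<rho> * \<beta> \<rho> \<le> N \<rho>" "M = N \<rho> + \<beta> \<rho>" using \<open>0 < M\<close> unfolding N_def by linarith+
  qed
  have le_a: "m \<le> a t \<rho> \<longleftrightarrow> m \<le> w \<rho> \<and> m * N \<rho> < Suc t * w \<rho>" if "\<rho> < r" "t < M" for m t \<rho>
  proof -
    have "0 < Suc t * w \<rho>" using w[OF that(1)] by simp
    then have "m * N \<rho> \<le> Suc t * w \<rho> - 1 \<longleftrightarrow> m * N \<rho> < Suc t * w \<rho>" by linarith
    then show ?thesis using N_pos[OF that(1)] that(2) by (simp add: a_def less_eq_div_iff_mult_less_eq)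
  qed
  have le_b: "m \<le> b t \<rho> \<longleftrightarrow> m \<le> w \<rho> \<and> m * N \<rho> \<le> (M - Suc t) * w \<rho>" if "\<rho> < r" "t < M" for m t \<rho>
    using N_pos[OF that(1)] that(2) by (simp add: b_def less_eq_div_iff_mult_less_eq)
  have mono: "a t \<rho> \<le> a t \<sigma> \<and> b t \<rho> \<le> b t \<sigma>" if "\<rho> < \<sigma>" "\<sigma> < r" "t < M" for t \<rho> \<sigma>
  proof -
    have \<rho>: "\<rho> < r" using that by simp
    have w0: "0 < w \<rho>" "0 < w \<sigma>" using w \<rho> that(2) by (simp_all add: Suc_le_eq)
    have sl: "m * N \<sigma> * w \<rho> \<le> m * N \<rho> * w \<sigma>" for m
      using mult_le_mono2[OF slope[OF that(1,2)], of m] by (simp add: N_def ac_simps)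
    have "a t \<rho> \<le> w \<rho>" "a t \<rho> * N \<rho> < Suc t * w \<rho>" using le_a[OF \<rho> that(3)] by blast+
    have "a t \<rho> * N \<rho> * w \<sigma> < Suc t * w \<rho> * w \<sigma>"
      using \<open>a t \<rho> * N \<rho> < Suc t * w \<rho>\<close> w0(2) by (rule mult_less_mono1)
    with sl have "a t \<rho> * N \<sigma> * w \<rho> < Suc t * w \<rho> * w \<sigma>" by (rule le_less_trans)
    then have "a t \<rho> * N \<sigma> * w \<rho> < Suc t * w \<sigma> * w \<rho>" by (simp only: ac_simps)
    then have 1: "a t \<rho> * N \<sigma> < Suc t * w \<sigma>" by (simp only: mult_less_cancel2)
    have "b t \<rho> * N \<rho> \<le> (M - Suc t) * w \<rho>" "b t \<rho> \<le> w \<rho>" using le_b[OF \<rho> that(3)] by blast+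
    then have "b t \<rho> * N \<rho> * w \<sigma> \<le> (M - Suc t) * w \<rho> * w \<sigma>" by (intro mult_le_mono1)
    with sl have "b t \<rho> * N \<sigma> * w \<rho> \<le> (M - Suc t) * w \<rho> * w \<sigma>" by (rule order_trans)
    then have "b t \<rho> * N \<sigma> * w \<rho> \<le> (M - Suc t) * w \<sigma> * w \<rho>" by (simp only: ac_simps)
    then have 2: "b t \<rho> * N \<sigma> \<le> (M - Suc t) * w \<sigma>"
      using mult_le_cancel2 w0(1) by blast
    show ?thesis
      using 1 2 le_a[OF that(2,3)] le_b[OF that(2,3)] w_mono[OF that(1,2)]
        \<open>a t \<rho> \<le> w \<rho>\<close> \<open>b t \<rho> \<le> w \<rho>\<close> by auto
  qed
  have rows: "a t \<rho> + b t \<rho> = w \<rho> \<or> a t \<rho> + b t \<rho> + 1 = w \<rho>"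
    and off: "off t \<rho> < Suc t * w \<rho>"
      "Suc t * w \<rho> \<le> off t \<rho> + count P (a t \<rho> + b t \<rho> + 2 * \<rho> + 1) * w \<rho>"
    if "\<rho> < r" "t < M" for t \<rho>
  proof -
    let ?a = "a t \<rho>" and ?b = "b t \<rho>" and ?w = "w \<rho>" and ?N = "N \<rho>"
    have M0: "0 < M" using that by simp
    note N0 = N_pos[OF that(1) M0] and wN = wN[OF that(1) M0] and MN = MN[OF that(1) M0]
    have split: "Suc t * ?w + (M - Suc t) * ?w = ?N * ?w + \<beta> \<rho> * ?w"
      using that(2) MN by (metis Suc_leI add_mult_distrib le_add_diff_inverse)
    have a: "?a \<le> ?w" "?a * ?N < Suc t * ?w" "?a < ?w \<Longrightarrow> Suc t * ?w \<le> Suc ?a * ?N"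
      using le_a[OF that, of ?a] le_a[OF that, of "Suc ?a"] by auto
    have b: "?b \<le> ?w" "?b * ?N \<le> (M - Suc t) * ?w" "?b < ?w \<Longrightarrow> (M - Suc t) * ?w < Suc ?b * ?N"
      using le_b[OF that, of ?b] le_b[OF that, of "Suc ?b"] by auto
    \<comment> \<open>The total length is \<open>w\<close> periods plus one upper block, at most
      \<open>w + 1\<close> periods. The bounds on \<open>a\<close> and \<open>b\<close> add up to
      \<open>a + b \<le> w\<close>, and their failure at the successors to
      \<open>w < a + b + 2\<close>.\<close>
    have "(?a + ?b) * ?N < (?w + 1) * ?N"
      using a(2) b(2) split wN by (simp add: algebra_simps)
    then have up: "?a + ?b \<le> ?w" by (metis Suc_eq_plus1 less_Suc_eq_le mult_less_cancel2)
    have "?w * ?N < (?a + ?b + 2) * ?N" if "?a < ?w" "?b < ?w"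
      using a(3)[OF that(1)] b(3)[OF that(2)] split by (simp add: algebra_simps)
    then have "?w < ?a + ?b + 2" if "?a < ?w" "?b < ?w" using that by (metis mult_less_cancel2)
    then show R: "?a + ?b = ?w \<or> ?a + ?b + 1 = ?w" using up by linarith
    show "off t \<rho> < Suc t * ?w"
    proof (cases "?a + ?b = ?w")
      case True
      then show ?thesis using a(2) by (simp add: off_def)
    next
      case False
      then have s: "?a + ?b + 1 = ?w" using R by simp
      then have "(M - Suc t) * ?w < Suc ?b * ?N" using b(3) by simp
      moreover have "?N * ?w = ?a * ?N + Suc ?b * ?N" using s by (metis Suc_eq_plus1 add.assoc add_mult_distrib mult.commute)
      ultimately show ?thesis using split False by (simp add: off_def)
    qed
    show "Suc t * ?w \<le> off t \<rho> + count P (?a + ?b + 2 * \<rho> + 1) * ?w"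
    proof (cases "?a + ?b = ?w")
      case True
      have "?N * ?w = ?a * ?N + ?b * ?N" using True by (metis add_mult_distrib mult.commute)
      then have "Suc t * ?w \<le> ?a * ?N + \<beta> \<rho> * ?w" using split b(2) by linarith
      also have "\<dots> \<le> ?a * ?N + count P (?a + ?b + 2 * \<rho> + 1) * ?w"
        using upper[OF that(1)] True by simp
      finally show ?thesis using True by (simp add: off_def)
    next
      case False
      then have s: "?a + ?b + 1 = ?w" using R by simp
      then have "Suc t * ?w \<le> Suc ?a * ?N" using a(3) by simp
      moreover have "?N \<le> \<beta> \<rho> * ?w + count P (?w + 2 * \<rho>) * ?w"
        using lower[OF that(1)] MN by (simp add: algebra_simps)
      moreover have row: "?a + ?b + 2 * \<rho> + 1 = ?w + 2 * \<rho>" using s by simp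
      ultimately show ?thesis unfolding row using False by (simp add: off_def)
    qed
  qed
  have e_D: "e t \<rho> \<in> D_elems P" if "\<rho> < r" "t < M" for t \<rho>
  proof -
    have w0: "0 < w \<rho>" using w[OF that(1)] by simp
    have "off t \<rho> div w \<rho> < Suc t" using off(1)[OF that] w0 by (simp add: div_less_iff_less_mult)
    moreover have "Suc t \<le> off t \<rho> div w \<rho> + count P (a t \<rho> + b t \<rho> + 2 * \<rho> + 1)"
    proof -
      have "Suc t = (Suc t * w \<rho>) div w \<rho>" using w0 by simp
      also have "\<dots> \<le> (off t \<rho> + count P (a t \<rho> + b t \<rho> + 2 * \<rho> + 1) * w \<rho>) div w \<rho>"
        using off(2)[OF that] by (rule div_le_mono)
      finally show ?thesis using w0 by simp
    qed
    ultimately show ?thesis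
      unfolding e_def D_elems_iff count_greater_zero_iff[symmetric] by linarith
  qed
  have e_inj: "t = t' \<and> \<rho> = \<rho>'" if "\<rho> < r" "t < M" "\<rho>' < r" "t' < M" "e t \<rho> = e t' \<rho>'" for t t' \<rho> \<rho>'
  proof -
    have rk: "a t \<rho> + \<rho> = a t' \<rho>' + \<rho>'" "b t \<rho> + \<rho> = b t' \<rho>' + \<rho>'"
      using that(5) by (auto simp: e_def)
    \<comment> \<open>\<open>a + b + 2 * \<rho>\<close> is \<open>w \<rho> + 2 * \<rho>\<close> or
      one less, and by \<open>w_mono\<close> these values differ for different ranks. Row and
      position then fix the block, and the copy number fixes \<open>t\<close>.\<close>
    have "\<rho> = \<rho>'"
      using rk rows[OF that(1,2)] rows[OF that(3,4)] w_mono[of \<rho> \<rho>'] w_mono[of \<rho>' \<rho>] that(1,3)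
      by linarith
    moreover from this have "off t \<rho> = off t' \<rho>" using rk by (simp add: off_def)
    ultimately have eq: "Suc t - off t \<rho> div w \<rho> = Suc t' - off t \<rho> div w \<rho>"
      and "off t \<rho> < Suc t * w \<rho>" "off t \<rho> < Suc t' * w \<rho>"
      using that(5) off(1)[OF that(1,2)] off(1)[OF that(3,4)] by (auto simp: e_def)
    moreover have "0 < w \<rho>" using w[OF that(1)] by simp
    ultimately have "off t \<rho> div w \<rho> < Suc t" "off t \<rho> div w \<rho> < Suc t'"
      by (simp_all only: div_less_iff_less_mult)
    with eq have "t = t'" by linarith
    then show ?thesis using \<open>\<rho> = \<rho>'\<close> by simp
  qed
  \<comment> \<open>The distances to both ends grow strictly with the rank, whereas in comparable
    elements one grows only if the other does not.\<close>
  have anti: "(e t \<rho>, e t \<sigma>) \<notin> D_order P \<and> (e t \<sigma>, e t \<rho>) \<notin> D_order P"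
    if "\<rho> < \<sigma>" "\<sigma> < r" "t < M" for t \<rho> \<sigma>
    using mono[OF that] that(1) D_order_imp[of _ _ _ _ _ _ P] by (fastforce simp: e_def)
  have "\<exists>\<rho><r. e t \<rho> \<notin> \<Union>(set Cs)" if "t < M" for t
  proof (rule ccontr)
    assume "\<not> ?thesis"
    then have "\<exists>i<length Cs. e t \<rho> \<in> Cs ! i" if "\<rho> < r" for \<rho>
      using that by (metis UnionE in_set_conv_nth)
    then obtain f where f: "\<And>\<rho>. \<rho> < r \<Longrightarrow> f \<rho> < length Cs \<and> e t \<rho> \<in> Cs ! f \<rho>" by metis
    then have "card (f ` {..<r}) < card {..<r}"
      using Cs(2) card_mono[of "{..<length Cs}" "f ` {..<r}"] by (auto simp: image_subset_iff)
    then have "\<not> inj_on f {..<r}" using pigeonhole by blast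
    then obtain \<rho> \<sigma> where rs: "\<rho> < \<sigma>" "\<sigma> < r" "f \<rho> = f \<sigma>"
      unfolding inj_on_def by (metis lessThan_iff linorder_neqE_nat)
    then have "e t \<rho> \<in> Cs ! f \<rho>" "e t \<sigma> \<in> Cs ! f \<rho>" "Cs ! f \<rho> \<in> Chains (D_order P)"
      using f[of \<rho>] f[of \<sigma>] Cs(1) by auto
    then show False using anti[OF rs(1,2) that] by (auto simp: Chains_def)
  qed
  then obtain g where g: "\<And>t. t < M \<Longrightarrow> g t < r \<and> e t (g t) \<notin> \<Union>(set Cs)" by metis
  have "inj_on (\<lambda>t. e t (g t)) {..<M}"
    by (intro inj_onI) (use e_inj g in \<open>meson lessThan_iff\<close>)
  moreover have "(\<lambda>t. e t (g t)) ` {..<M} \<subseteq> D_elems P - \<Union>(set Cs)" using e_D g by auto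
  ultimately show ?thesis
    using card_inj_on_le[of "\<lambda>t. e t (g t)" "{..<M}"] finite_D_elems[of P] by simp
qed

section \<open>The runs of a partition\<close>

text \<open>Spreads are recorded by their supports only; multiplicities are read off from
  \<open>P\<close>. As \<open>p k + s k\<close> is never a part, the zero multiplicity past the last
  part of a spread needs no convention.\<close>

locale run_decomposition =
  fixes P :: "nat multiset" and l :: nat and p s :: "nat \<Rightarrow> nat"
  assumes l_pos: "0 < l"
    and p_pos: "k < l \<Longrightarrow> 0 < p k"
    and s_pos: "k < l \<Longrightarrow> 0 < s k"
    and gap: "Suc k < l \<Longrightarrow> p k + s k < p (Suc k)"
    and parts_iff: "q \<in># P \<longleftrightarrow> (\<exists>k<l. p k \<le> q \<and> q < p k + s k)"
begin

text \<open>The \<open>k\<close>-th run is the \<open>s k\<close>-spread with smallest part \<open>p k\<close>; \<open>h\<close>, \<open>R\<close> and \<open>w\<close> are its \<open>r\<close>, its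
  \<open>r\<close>-bar and its smallest part after the shift. In \<open>val\<close> the indices \<open>i\<close>, \<open>j\<close> start at 0.\<close>

definition h :: "nat \<Rightarrow> nat" where
  "h k = (s k + 1) div 2"

definition R :: "nat \<Rightarrow> nat" where
  "R k = (\<Sum>i<k. h i)"

definition w :: "nat \<Rightarrow> nat" where
  "w k = p k - 2 * R k"

definition val :: "nat \<Rightarrow> nat \<Rightarrow> nat \<Rightarrow> nat" where
  "val k i j = w k * count P (p k + 2 * i) + (w k + 1) * count P (p k + 2 * j + 1)"

text \<open>The rank of the pair of rows to which the row \<open>q\<close> belongs.\<close>

definition \<gamma> :: "nat \<Rightarrow> nat" where
  "\<gamma> q = (let k = (LEAST k. q < p k + s k) in R k + (q - p k) div 2)"

lemma R_Suc: "R (Suc k) = R k + h k"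
  by (simp add: R_def)

lemma R_mono: "k \<le> k' \<Longrightarrow> R k \<le> R k'"
  unfolding R_def by (rule sum_mono2) auto

lemma no_zero: "0 \<notin># P"
  using p_pos parts_iff[of 0] by auto

lemma gap_less: "k < k' \<Longrightarrow> k' < l \<Longrightarrow> p k + s k < p k'"
proof (induction k' rule: less_Suc_induct)
  case (1 i)
  then show ?case using gap by simp
next
  case (2 i j k)
  then show ?case by (meson add_lessD1 less_trans)
qed

text \<open>\<open>2 * h k\<close> is at most \<open>s k + 1\<close>, and the gap makes the smallest
  part grow by at least as much; so the subtraction in \<open>w\<close> does not truncate.\<close>

lemma R_less: "k < l \<Longrightarrow> 2 * R k < p k"
proof (induction k)
  case 0
  then show ?case using p_pos by (simp add: R_def)
next
  case (Suc k)
  then show ?case using gap[of k] by (simp add: R_Suc h_def)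
qed

lemma w_pos: "k < l \<Longrightarrow> 0 < w k"
  using R_less by (simp add: w_def)

text \<open>For even \<open>s k\<close>, \<open>2 * h k = s k\<close> is one less than the minimal
  growth of the smallest part. The unit gained serves the slope condition between runs.\<close>

lemma w_gap: "k < k' \<Longrightarrow> k' < l \<Longrightarrow> w k + of_bool (even (s k)) \<le> w k'"
proof -
  have step: "w k + of_bool (even (s k)) \<le> w (Suc k)" if "Suc k < l" for k
  proof -
    have "2 * h k + of_bool (even (s k)) \<le> s k + 1" unfolding h_def by (auto elim!: evenE oddE)
    moreover have "x - 2 * r + e \<le> y - 2 * (r + d)"
      if "2 * d + e \<le> z + 1" "x + z < y" "2 * r < x" for d e r x y z :: nat
      using that by arith
    ultimately show ?thesis using gap[OF that] R_less[OF Suc_lessD[OF that]]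
      unfolding w_def R_Suc by blast
  qed
  show "k < k' \<Longrightarrow> k' < l \<Longrightarrow> w k + of_bool (even (s k)) \<le> w k'"
  proof (induction k' rule: less_Suc_induct)
    case (1 i)
    then show ?case using step by simp
  next
    case (2 i j k)
    then show ?case by (meson add_leD1 less_trans order_trans)
  qed
qed

lemma run_end_notin: "k < l \<Longrightarrow> p k + s k \<notin># P"
  using gap_less[of k] gap_less[of _ k] s_pos[of k] unfolding parts_iff
  by (metis linorder_neqE_nat less_irrefl not_add_less1 not_le order.strict_trans)

lemma run_eqI:
  assumes "k < l" "p k \<le> q" "q < p k + s k"
  shows "(LEAST k. q < p k + s k) = k"
  using assms gap_less[of _ k] by (intro Least_equality) (fastforce simp: not_less[symmetric])+

lemma \<gamma>_run: "k < l \<Longrightarrow> p k \<le> q \<Longrightarrow> q < p k + s k \<Longrightarrow> \<gamma> q = R k + (q - p k) div 2"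
  by (simp add: \<gamma>_def run_eqI)

lemma \<gamma>_bounds:
  assumes "k < l" "p k \<le> q" "q < p k + s k"
  shows "R k \<le> \<gamma> q" "\<gamma> q < R (Suc k)"
proof -
  have "(q - p k) div 2 < h k" using assms unfolding h_def by linarith
  then show "R k \<le> \<gamma> q" "\<gamma> q < R (Suc k)" using \<gamma>_run[OF assms] by (simp_all add: R_Suc)
qed

lemma runs_cases:
  assumes "q \<in># P" "q' \<in># P" "q \<le> q'"
  obtains (same) k where "k < l" "p k \<le> q" "q' < p k + s k"
  | (less) k k' where "k < k'" "k' < l" "p k \<le> q" "q < p k + s k" "p k' \<le> q'" "q' < p k' + s k'"
proof -
  obtain k k' where k: "k < l" "p k \<le> q" "q < p k + s k" "k' < l" "p k' \<le> q'" "q' < p k' + s k'"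
    using assms parts_iff by meson
  consider "k < k'" | "k = k'" | "k' < k" by linarith
  then show ?thesis
  proof cases
    case 3
    then show ?thesis using gap_less[of k' k] k assms(3) by linarith
  qed (use k that in blast)+
qed

lemma \<gamma>_less_of_runs:
  assumes "k < k'" "k' < l" "p k \<le> q" "q < p k + s k" "p k' \<le> q'" "q' < p k' + s k'"
  shows "\<gamma> q < \<gamma> q'"
  using \<gamma>_bounds(2)[of k q] \<gamma>_bounds(1)[of k' q'] R_mono[of "Suc k" k'] assms by simp

lemma \<gamma>_mono:
  assumes "q \<in># P" "q' \<in># P" "q \<le> q'"
  shows "\<gamma> q \<le> \<gamma> q'"
  using assms
proof (cases rule: runs_cases)
  case (same k)
  then show ?thesis using assms(3) by (simp add: \<gamma>_run div_le_mono)
next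
  case (less k k')
  then show ?thesis using \<gamma>_less_of_runs by (meson less_imp_le)
qed

lemma \<gamma>_adjacent:
  assumes "q \<in># P" "q' \<in># P" "q < q'" "\<gamma> q = \<gamma> q'"
  shows "q' = Suc q"
  using assms(1,2) less_imp_le[OF assms(3)]
proof (cases rule: runs_cases)
  case (same k)
  then have "(q - p k) div 2 = (q' - p k) div 2" using assms(3,4) by (simp add: \<gamma>_run)
  then show ?thesis using same assms(3) by linarith
next
  case (less k k')
  then show ?thesis using \<gamma>_less_of_runs assms(4) by (metis less_irrefl)
qed

lemma \<gamma>_less: "q \<in># P \<Longrightarrow> \<gamma> q < R l"
  using \<gamma>_bounds(2) R_mono unfolding parts_iff by (metis Suc_leI order_less_le_trans)

section \<open>Covers by \<open>R l\<close> and by \<open>R l - 1\<close> chains\<close>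

lemma full_cover:
  obtains Cs where "set Cs \<subseteq> Chains (D_order P)" "length Cs = R l" "D_elems P \<subseteq> \<Union>(set Cs)"
proof -
  obtain Cs where Cs: "set Cs \<subseteq> Chains (D_order P)" "length Cs = R l"
    "D_elems P - \<Union>(set Cs) \<subseteq> {(u, q, k) \<in> D_elems P. \<not> True \<and> \<gamma> q < u \<and> u + \<gamma> q \<le> q}"
    by (rule chain_coverI[OF no_zero, of \<gamma> "\<lambda>_. True" "R l"])
      (use \<gamma>_mono \<gamma>_adjacent \<gamma>_less in \<open>auto intro: less_imp_le\<close>)
  then show ?thesis using that[of Cs] by auto
qed

text \<open>Without the rows \<open>p k + 2 i\<close> and \<open>p k + 2 j + 1\<close>, the rows in between can be paired the other way
  round, which saves one chain.\<close>

lemma almost_cover: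
  assumes k: "k < l" and ij: "i \<le> j" "j < h k"
  obtains Cs where "set Cs \<subseteq> Chains (D_order P)" "length Cs = R l - 1"
    "card (D_elems P - \<Union>(set Cs)) \<le> val k i j"
proof -
  define a b where "a = p k + 2 * i" and "b = p k + 2 * j + 1"
  \<comment> \<open>The rows between \<open>a\<close> and \<open>b\<close> are paired as
    \<open>a + 1, a + 2\<close>, then \<open>a + 3, a + 4\<close> and so on; above \<open>b\<close>
    all ranks drop by one.\<close>
  define g where "g q = (if q \<le> a then \<gamma> q else if q \<le> b then R k + (q - p k - 1) div 2 else \<gamma> q - 1)" for q
  define m where "m = R k + j"
  have s: "2 * j < s k" using ij by (simp add: h_def)
  have m: "m \<le> R l - 1" "0 < R l" using R_mono[of "Suc k" l] k ij by (auto simp: m_def R_Suc)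
  have a: "\<gamma> a = R k + i" using \<gamma>_run[OF k, of a] s ij by (simp add: a_def)
  have mid: "R k + i \<le> g q" "g q \<le> m" "q \<noteq> b \<Longrightarrow> g q < m" if "a < q" "q \<le> b" for q
    using that by (auto simp: g_def a_def b_def m_def)
  have low: "\<gamma> q < R k + i" if "q \<in># P" "q < a" for q
  proof -
    have "q \<in># P" by (rule that)
    then obtain k' where k': "k' < l" "p k' \<le> q" "q < p k' + s k'" unfolding parts_iff by blast
    consider "k' < k" | "k' = k" | "k < k'" by linarith
    then show ?thesis
    proof cases
      case 1
      then show ?thesis using \<gamma>_bounds(2)[OF k'] R_mono[of "Suc k'" k] by simp
    next
      case 2
      then show ?thesis using \<gamma>_run[OF k'] that(2) k' by (simp add: a_def)
    next
      case 3
      then show ?thesis using gap_less[OF 3 k'(1)] k' that s ij by (simp add: a_def)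
    qed
  qed
  have high: "m < \<gamma> q" if "q \<in># P" "b < q" for q
  proof -
    have "q \<in># P" by (rule that)
    then obtain k' where k': "k' < l" "p k' \<le> q" "q < p k' + s k'" unfolding parts_iff by blast
    consider "k' < k" | "k' = k" | "k < k'" by linarith
    then show ?thesis
    proof cases
      case 1
      then show ?thesis using gap_less[OF 1 k] k' that by (simp add: b_def)
    next
      case 2
      then show ?thesis using \<gamma>_run[OF k'] that(2) k' by (simp add: b_def m_def)
    next
      case 3
      then show ?thesis using \<gamma>_bounds(1)[OF k'] R_mono[of "Suc k" k'] ij by (simp add: m_def R_Suc)
    qed
  qed
  have g_low: "g q = \<gamma> q" if "q \<le> a" for q using that by (simp add: g_def)
  have g_high: "g q = \<gamma> q - 1" if "b < q" for q using that ij by (simp add: g_def a_def b_def)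
  have low': "g q \<le> R k + i" if "q \<in># P" "q \<le> a" for q
    using that low[of q] a g_low by (cases "q = a") auto
  have "R k + i \<le> m" using ij by (simp add: m_def)
  \<comment> \<open>\<open>g b = m\<close> may equal \<open>R l - 1\<close>, a rank without a chain;
    this is allowed because \<open>b\<close> is not kept.\<close>
  obtain Cs where Cs: "set Cs \<subseteq> Chains (D_order P)" "length Cs = R l - 1"
    "D_elems P - \<Union>(set Cs) \<subseteq> {(u, q, k) \<in> D_elems P. \<not> (q \<noteq> a \<and> q \<noteq> b) \<and> g q < u \<and> u + g q \<le> q}"
  proof (rule chain_coverI[OF no_zero, of g "\<lambda>q. q \<noteq> a \<and> q \<noteq> b" "R l - 1"])
    fix q q' assume q: "q \<in># P" "q' \<in># P" "q \<le> q'"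
    consider "q' \<le> a" | "q \<le> a" "a < q'" "q' \<le> b" | "q \<le> a" "b < q'" | "a < q" "q' \<le> b" | "a < q" "q \<le> b" "b < q'" | "b < q"
      using q(3) by linarith
    then show "g q \<le> g q'"
    proof cases
      case 1
      then show ?thesis using q \<gamma>_mono g_low by simp
    next
      case 2
      then show ?thesis using low'[OF q(1)] mid(1) by fastforce
    next
      case 3
      then show ?thesis using low'[OF q(1)] high[OF q(2)] g_high \<open>R k + i \<le> m\<close> by fastforce
    next
      case 4
      then show ?thesis using q(3) by (simp add: g_def div_le_mono)
    next
      case 5
      then show ?thesis using mid(2)[of q] high[OF q(2)] g_high by fastforce
    next
      case 6
      then show ?thesis using q \<gamma>_mono[OF q] g_high by simp
    qed
  next
    fix q q' assume q: "q \<in># P" "q' \<in># P" "q \<noteq> a \<and> q \<noteq> b" "q' \<noteq> a \<and> q' \<noteq> b" "q < q'" "g q = g q'"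
    consider "q' < a" | "q < a" "a < q'" "q' < b" | "q < a" "b < q'" | "a < q" "q' < b" | "a < q" "q < b" "b < q'" | "b < q"
      using q by linarith
    then show "q' = Suc q"
    proof cases
      case 1
      then show ?thesis using q \<gamma>_adjacent g_low by simp
    next
      case 2
      then show ?thesis using low[OF q(1)] mid(1)[of q'] g_low[of q] q(6) by simp
    next
      case 3
      then show ?thesis using low[OF q(1)] high[OF q(2)] g_low[of q] g_high[of q'] \<open>R k + i \<le> m\<close> q(6) by simp
    next
      case 4
      then have "(q - p k - 1) div 2 = (q' - p k - 1) div 2" using q(5,6) by (simp add: g_def)
      then show ?thesis using 4 q(5) by (simp add: a_def)
    next
      case 5
      then show ?thesis using mid(3)[of q] high[OF q(2)] g_high[of q'] q(6) by simp
    next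
      case 6
      then show ?thesis
        using q \<gamma>_adjacent[OF q(1,2,5)] g_high[of q] g_high[of q'] high[of q] high[of q'] by simp
    qed
  next
    fix q assume q: "q \<in># P"
    consider "q \<le> a" | "a < q" "q \<le> b" | "b < q" by linarith
    then show "g q \<le> R l - 1"
      using low'[OF q] mid(2)[of q] \<gamma>_less[OF q] g_high[of q] m \<open>R k + i \<le> m\<close> by cases simp_all
  next
    fix q assume q: "q \<in># P" "q \<noteq> a \<and> q \<noteq> b"
    then consider "q < a" | "a < q" "q < b" | "b < q" by linarith
    then show "g q < R l - 1"
    proof cases
      case 1
      then show ?thesis using low[OF q(1)] g_low[of q] m \<open>R k + i \<le> m\<close> by simp
    next
      case 2
      then show ?thesis using mid(3)[of q] m q by simp
    next
      case 3
      then show ?thesis using \<gamma>_less[OF q(1)] g_high[of q] high[OF q(1)] by simp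
    qed
  qed
  \<comment> \<open>Rank \<open>g\<close> removes \<open>g\<close> positions at each end of a row;
    what remains gives the coefficients in \<open>val\<close>.\<close>
  have ga: "a - 2 * g a = w k" using a g_low[of a] by (simp add: a_def w_def)
  have gb: "b - 2 * g b = w k + 1"
    using ij R_less[OF k] by (simp add: g_def a_def b_def w_def)
  let ?U = "\<lambda>c. {(u, q, k) \<in> D_elems P. q = c \<and> g c < u \<and> u + g c \<le> c}"
  have "D_elems P - \<Union>(set Cs) \<subseteq> ?U a \<union> ?U b" using Cs(3) by auto
  moreover have "finite (?U a \<union> ?U b)" by (rule finite_subset[OF _ finite_D_elems[of P]]) auto
  ultimately have "card (D_elems P - \<Union>(set Cs)) \<le> card (?U a) + card (?U b)"
    by (meson card_Un_le card_mono order_trans)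
  also have "\<dots> \<le> val k i j"
    using card_uncovered_row[of P a "g a"] card_uncovered_row[of P b "g b"]
    unfolding ga gb val_def a_def[symmetric] b_def[symmetric] by linarith
  finally show ?thesis using that Cs(1,2) by blast
qed

section \<open>What fewer than \<open>R l\<close> chains leave uncovered\<close>

lemma rank_cases:
  assumes "\<rho> < R l"
  obtains k i where "k < l" "i < h k" "\<rho> = R k + i"
proof -
  have "\<rho> < R n \<Longrightarrow> \<exists>k<n. R k \<le> \<rho> \<and> \<rho> < R (Suc k)" for n
  proof (induction n)
    case (Suc n)
    then show ?case by (metis less_Suc_eq not_le)
  qed (simp add: R_def)
  then obtain k where "k < l" "R k \<le> \<rho>" "\<rho> < R (Suc k)" using assms by blast
  then show ?thesis using that[of k "\<rho> - R k"] by (simp add: R_Suc)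
qed

lemma uncovered_ge:
  assumes M: "\<And>k i j. k < l \<Longrightarrow> i \<le> j \<Longrightarrow> j < h k \<Longrightarrow> M \<le> val k i j"
    and Cs: "set Cs \<subseteq> Chains (D_order P)" "length Cs < R l"
  shows "M \<le> card (D_elems P - \<Union>(set Cs))"
proof -
  \<comment> \<open>The minimum over all \<open>j \<ge> i\<close> makes \<open>B k i\<close>
    non-decreasing in \<open>i\<close>, as the slope condition requires, and the bound on
    \<open>val\<close> still applies at the \<open>j\<close> attaining it.\<close>
  define B where "B k i = Min ((\<lambda>j. count P (p k + 2 * j + 1)) ` {i..<h k})" for k i
  have B_le: "B k i \<le> count P (p k + 2 * j + 1)" if "i \<le> j" "j < h k" for k i j
    unfolding B_def using that by (intro Min_le) auto
  have B_in: "\<exists>j\<ge>i. j < h k \<and> B k i = count P (p k + 2 * j + 1)" if "i < h k" for k i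
  proof -
    have "B k i \<in> (\<lambda>j. count P (p k + 2 * j + 1)) ` {i..<h k}"
      unfolding B_def using that by (intro Min_in) auto
    then show ?thesis by auto
  qed
  have "\<exists>k i. \<rho> < R l \<longrightarrow> k < l \<and> i < h k \<and> \<rho> = R k + i" for \<rho> using rank_cases by metis
  then obtain K I where KI: "\<And>\<rho>. \<rho> < R l \<Longrightarrow> K \<rho> < l \<and> I \<rho> < h (K \<rho>) \<and> \<rho> = R (K \<rho>) + I \<rho>" by metis
  \<comment> \<open>The cap \<open>M div (W \<rho> + 1)\<close> lets the \<open>W \<rho> + 1\<close>
    upper blocks fit into length \<open>M\<close>.\<close>
  define W \<beta> where "W \<rho> = w (K \<rho>)" and "\<beta> \<rho> = min (B (K \<rho>) (I \<rho>)) (M div (W \<rho> + 1))" for \<rho>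
  have row: "W \<rho> + 2 * \<rho> = p (K \<rho>) + 2 * I \<rho>" if "\<rho> < R l" for \<rho>
    using KI[OF that] R_less[of "K \<rho>"] unfolding W_def w_def by linarith
  have small: "(W \<rho> + 1) * \<beta> \<rho> \<le> M" for \<rho>
  proof -
    have "(W \<rho> + 1) * \<beta> \<rho> \<le> (W \<rho> + 1) * (M div (W \<rho> + 1))"
      by (intro mult_le_mono2) (simp add: \<beta>_def)
    also have "\<dots> \<le> M" by (rule times_div_less_eq_dividend)
    finally show ?thesis .
  qed
  have K_mono: "K \<rho> < K \<sigma> \<or> K \<rho> = K \<sigma> \<and> I \<rho> < I \<sigma>" if "\<rho> < \<sigma>" "\<sigma> < R l" for \<rho> \<sigma>
  proof -
    have "\<not> K \<sigma> < K \<rho>"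
      using KI[of \<rho>] KI[of \<sigma>] that R_mono[of "Suc (K \<sigma>)" "K \<rho>"] by (auto simp: R_Suc)
    then show ?thesis using KI[of \<rho>] KI[of \<sigma>] that by (metis add_less_cancel_left less_trans linorder_neqE_nat)
  qed
  show ?thesis
  proof (rule antichains_bound[OF _ _ small _ _ _ Cs])
    fix \<rho> assume \<rho>: "\<rho> < R l"
    show "1 \<le> W \<rho>" using w_pos KI[OF \<rho>] by (simp add: W_def Suc_le_eq)
    have "\<beta> \<rho> \<le> B (K \<rho>) (I \<rho>)" by (simp add: \<beta>_def)
    also have "\<dots> \<le> count P (W \<rho> + 2 * \<rho> + 1)" unfolding row[OF \<rho>] using B_le KI[OF \<rho>] by blast
    finally show "\<beta> \<rho> \<le> count P (W \<rho> + 2 * \<rho> + 1)" .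
    show "M \<le> W \<rho> * count P (W \<rho> + 2 * \<rho>) + (W \<rho> + 1) * \<beta> \<rho>"
    proof (cases "B (K \<rho>) (I \<rho>) \<le> M div (W \<rho> + 1)")
      case True
      then have "\<beta> \<rho> = B (K \<rho>) (I \<rho>)" by (simp add: \<beta>_def)
      moreover obtain j where "I \<rho> \<le> j" "j < h (K \<rho>)" "B (K \<rho>) (I \<rho>) = count P (p (K \<rho>) + 2 * j + 1)"
        using B_in KI[OF \<rho>] by blast
      ultimately show ?thesis unfolding row[OF \<rho>]
        using M[of "K \<rho>" "I \<rho>" j] KI[OF \<rho>] by (simp add: val_def W_def)
    next
      case False
      then have "\<beta> \<rho> = M div (W \<rho> + 1)" by (simp add: \<beta>_def)
      then have "(W \<rho> + 1) * \<beta> \<rho> + M mod (W \<rho> + 1) = M" by (simp only: mult_div_mod_eq)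
      moreover have "M mod (W \<rho> + 1) < W \<rho> + 1" by (rule mod_less_divisor) simp
      ultimately have "M \<le> W \<rho> + (W \<rho> + 1) * \<beta> \<rho>" by linarith
      moreover have "W \<rho> \<le> W \<rho> * count P (W \<rho> + 2 * \<rho>)"
      proof -
        have "p (K \<rho>) + 2 * I \<rho> \<in># P" unfolding parts_iff
          using KI[OF \<rho>] by (intro exI[of _ "K \<rho>"]) (auto simp: h_def)
        then show ?thesis unfolding row[OF \<rho>] by simp
      qed
      ultimately show ?thesis by linarith
    qed
  next
    fix \<rho> \<sigma> assume lt: "\<rho> < \<sigma>" "\<sigma> < R l"
    have K: "K \<rho> < l" "K \<sigma> < l" "I \<rho> < h (K \<rho>)" "I \<sigma> < h (K \<sigma>)" using KI lt by auto
    show W_le: "W \<rho> \<le> W \<sigma>" using K_mono[OF lt] w_gap K(2) by (fastforce simp: W_def)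
    show "W \<rho> * (M - \<beta> \<sigma>) \<le> W \<sigma> * (M - \<beta> \<rho>)"
    proof (cases "K \<rho> = K \<sigma>")
      case True
      then have "I \<rho> \<le> I \<sigma>" using K_mono[OF lt] by auto
      then have "B (K \<rho>) (I \<rho>) \<le> B (K \<sigma>) (I \<sigma>)"
        using B_in[OF K(4)] B_le[of "I \<rho>" _ "K \<rho>"] True by fastforce
      then have "\<beta> \<rho> \<le> \<beta> \<sigma>" using True by (auto simp: \<beta>_def W_def)
      then show ?thesis using True by (simp add: W_def diff_le_mono2)
    next
      case False
      then have K': "K \<rho> < K \<sigma>" using K_mono[OF lt] by auto
      \<comment> \<open>Between runs a stronger form holds. After an even run the unit from
        \<open>w_gap\<close> absorbs \<open>\<beta> \<rho>\<close>, by \<open>small\<close>; the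
        last pair of an odd run has no upper row, so \<open>\<beta> \<rho>\<close> is 0.\<close>
      have "W \<rho> * M \<le> W \<sigma> * (M - \<beta> \<rho>)"
      proof (cases "even (s (K \<rho>))")
        case True
        then have "W \<rho> + 1 \<le> W \<sigma>" using w_gap[OF K' K(2)] by (simp add: W_def)
        have "W \<rho> * M \<le> (W \<rho> + 1) * M - (W \<rho> + 1) * \<beta> \<rho>" using small[of \<rho>] by simp
        also have "\<dots> = (W \<rho> + 1) * (M - \<beta> \<rho>)" by (simp only: diff_mult_distrib2)
        also have "\<dots> \<le> W \<sigma> * (M - \<beta> \<rho>)" using \<open>W \<rho> + 1 \<le> W \<sigma>\<close> by (rule mult_le_mono1)
        finally show ?thesis .
      next
        case False
        then have last: "p (K \<rho>) + 2 * (h (K \<rho>) - 1) + 1 = p (K \<rho>) + s (K \<rho>)"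
          by (auto simp: h_def elim!: oddE)
        have "B (K \<rho>) (I \<rho>) \<le> count P (p (K \<rho>) + 2 * (h (K \<rho>) - 1) + 1)"
          using K(3) by (intro B_le) auto
        also have "\<dots> = 0" unfolding last using run_end_notin[OF K(1)] by (simp add: not_in_iff)
        finally have "B (K \<rho>) (I \<rho>) = 0" by simp
        then show ?thesis using W_le by (simp add: \<beta>_def)
      qed
      moreover have "W \<rho> * (M - \<beta> \<sigma>) \<le> W \<rho> * M" by simp
      ultimately show ?thesis by linarith
    qed
  qed
qed

lemma val_pos: "k < l \<Longrightarrow> i < h k \<Longrightarrow> 0 < val k i j"
  using w_pos[of k] parts_iff[of "p k + 2 * i"] by (force simp: val_def h_def)

lemma R_pos: "0 < R l"
  using R_mono[of 1 l] s_pos[of 0] l_pos by (simp add: R_def h_def Suc_le_eq)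

end

section \<open>Chain numbers and the smallest part of \<lambda>(P)\<close>

lemma union_chains_subset: "set Cs \<subseteq> Chains (D_order P) \<Longrightarrow> \<Union>(set Cs) \<subseteq> D_elems P"
  unfolding Chains_def D_order_def by blast

lemma finite_chain_cards:
  "finite {card (\<Union>(set Cs)) |Cs. length Cs = k \<and> set Cs \<subseteq> Chains (D_order P)}"
proof -
  have "card (\<Union>(set Cs)) \<le> card (D_elems P)" if "set Cs \<subseteq> Chains (D_order P)" for Cs
    using union_chains_subset[OF that] finite_D_elems card_mono by blast
  then show ?thesis by (auto intro!: finite_subset[of _ "{..card (D_elems P)}"])
qed

lemma chain_card_ge:
  assumes "set Cs \<subseteq> Chains (D_order P)" "length Cs = k"
  shows "card (\<Union>(set Cs)) \<le> chain_card P k"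
  unfolding chain_card_def using assms by (intro Max_ge[OF finite_chain_cards]) blast

lemma chain_card_attained:
  obtains Cs where "set Cs \<subseteq> Chains (D_order P)" "length Cs = k" "card (\<Union>(set Cs)) = chain_card P k"
proof -
  let ?S = "{card (\<Union>(set Cs)) |Cs. length Cs = k \<and> set Cs \<subseteq> Chains (D_order P)}"
  have "length (replicate k {}) = k" "set (replicate k {}) \<subseteq> Chains (D_order P)"
    by (auto simp: Chains_def)
  then have "?S \<noteq> {}" by blast
  then have "chain_card P k \<in> ?S" unfolding chain_card_def by (rule Max_in[OF finite_chain_cards])
  then show ?thesis using that by auto
qed

lemma chain_card_le: "chain_card P k \<le> card (D_elems P)"
  using chain_card_attained[of P k] union_chains_subset finite_D_elems card_mono by metis

lemma chain_card_mono: "k \<le> k' \<Longrightarrow> chain_card P k \<le> chain_card P k'"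
proof -
  assume k: "k \<le> k'"
  obtain Cs where Cs: "set Cs \<subseteq> Chains (D_order P)" "length Cs = k" "card (\<Union>(set Cs)) = chain_card P k"
    by (rule chain_card_attained)
  let ?Es = "Cs @ replicate (k' - k) {}"
  have "set ?Es \<subseteq> Chains (D_order P)" using Cs(1) by (auto simp: Chains_def)
  moreover have "\<Union>(set ?Es) = \<Union>(set Cs)" by auto
  ultimately show ?thesis using chain_card_ge[of ?Es P k'] Cs k by simp
qed

lemma chain_card_concave: "chain_card P k + chain_card P (k + 2) \<le> 2 * chain_card P (k + 1)"
proof -
  obtain Cs where Cs: "set Cs \<subseteq> Chains (D_order P)" "length Cs = k" "card (\<Union>(set Cs)) = chain_card P k"
    by (rule chain_card_attained)
  obtain Es where Es: "set Es \<subseteq> Chains (D_order P)" "length Es = k + 2"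
    "card (\<Union>(set Es)) = chain_card P (k + 2)"
    by (rule chain_card_attained)
  obtain Fs Gs where "set Fs \<subseteq> Chains (D_order P)" "length Fs = k + 1"
    "set Gs \<subseteq> Chains (D_order P)" "length Gs = k + 1"
    "card (\<Union>(set Cs)) + card (\<Union>(set Es)) \<le> card (\<Union>(set Fs)) + card (\<Union>(set Gs))"
    using chain_families_exchange[OF partial_order_on_D_order finite_D_elems Cs(1,2) Es(1,2)] .
  then show ?thesis using Cs(3) Es(3) chain_card_ge[of Fs P "k + 1"] chain_card_ge[of Gs P "k + 1"] by linarith
qed

text \<open>By concavity each increment of \<open>chain_card\<close> is at most the previous one.
  The range starts at 1 because truncation makes \<open>lam P 0\<close> zero.\<close>

lemma lam_antimono:
  assumes "1 \<le> k" "k \<le> k'"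
  shows "lam P k' \<le> lam P k"
  using assms(2,1)
proof (induction k' rule: dec_induct)
  case (step n)
  have "chain_card P (n - 1) \<le> chain_card P n" "chain_card P n \<le> chain_card P (Suc n)"
    by (simp_all add: chain_card_mono)
  then have "lam P (Suc n) \<le> lam P n"
    using chain_card_concave[of P "n - 1"] step by (simp add: lam_def)
  then show ?case using step by simp
qed simp

text \<open>Since \<open>r\<close> chains exhaust the poset, \<open>lam\<close> vanishes beyond
  \<open>r\<close>; being non-increasing, it has its least positive value at
  \<open>r\<close>.\<close>

lemma min_lam_eqI:
  assumes "0 < r" "chain_card P r = card (D_elems P)" "chain_card P (r - 1) + M = card (D_elems P)" "0 < M"
  shows "min_lam P = M"
proof -
  have M: "lam P r = M" using assms by (simp add: lam_def)
  have zero: "lam P k = 0" if "r < k" for k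
  proof -
    have "r \<le> k - 1" using that by simp
    then show ?thesis
      using chain_card_mono[of r "k - 1" P] chain_card_le[of P k] assms(2) by (simp add: lam_def)
  qed
  then have le: "k \<le> r" if "0 < lam P k" for k using that by (metis not_le less_irrefl)
  show ?thesis unfolding min_lam_def
  proof (rule Min_eqI)
    have "{lam P k |k. 1 \<le> k \<and> 0 < lam P k} \<subseteq> lam P ` {..r}" using le by blast
    then show "finite {lam P k |k. 1 \<le> k \<and> 0 < lam P k}" by (rule finite_subset) simp
    have "M = lam P r \<and> 1 \<le> r \<and> 0 < lam P r" using M assms(1,4) by simp
    then show "M \<in> {lam P k |k. 1 \<le> k \<and> 0 < lam P k}" by blast
  next
    fix y assume "y \<in> {lam P k |k. 1 \<le> k \<and> 0 < lam P k}"
    then obtain k where "y = lam P k" "1 \<le> k" "0 < lam P k" by blast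
    then show "M \<le> y" using lam_antimono[of k r P] le M by simp
  qed
qed

context run_decomposition begin

text \<open>\<open>almost_cover\<close> at a minimizing triple bounds the loss of
  \<open>R l - 1\<close> chains from above; \<open>uncovered_ge\<close> at an optimal family bounds
  it from below.\<close>

lemma min_lam_eq: "min_lam P = Min {val k i j |k i j. k < l \<and> i \<le> j \<and> j < h k}"
proof (rule min_lam_eqI[OF R_pos])
  let ?V = "{val k i j |k i j. k < l \<and> i \<le> j \<and> j < h k}"
  have "?V \<subseteq> (\<lambda>(k, i, j). val k i j) ` (SIGMA k:{..<l}. {..<h k} \<times> {..<h k})"
    by (auto simp: image_iff Bex_def) (metis order_le_less_trans)
  then have fin: "finite ?V" by (rule finite_subset) auto
  have "0 < h 0" using s_pos[OF l_pos] by (simp add: h_def)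
  then have "?V \<noteq> {}" using l_pos by blast
  then have "Min ?V \<in> ?V" using fin by (rule Min_in[rotated])
  then obtain k i j where kij: "k < l" "i \<le> j" "j < h k" "Min ?V = val k i j" by blast
  then show "0 < Min ?V" using val_pos by simp
  obtain Cs where Cs: "set Cs \<subseteq> Chains (D_order P)" "length Cs = R l" "D_elems P \<subseteq> \<Union>(set Cs)"
    by (rule full_cover)
  then show "chain_card P (R l) = card (D_elems P)"
    using chain_card_ge[OF Cs(1,2)] chain_card_le[of P "R l"] union_chains_subset[OF Cs(1)]
    by (metis le_antisym subset_antisym)
  have split: "card (\<Union>(set Cs)) + card (D_elems P - \<Union>(set Cs)) = card (D_elems P)"
    if "set Cs \<subseteq> Chains (D_order P)" for Cs
    using union_chains_subset[OF that] finite_D_elems[of P]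
    by (simp add: card_Diff_subset card_mono finite_subset)
  obtain Es where Es: "set Es \<subseteq> Chains (D_order P)" "length Es = R l - 1"
    "card (D_elems P - \<Union>(set Es)) \<le> val k i j"
    by (rule almost_cover[OF kij(1-3)])
  obtain Fs where Fs: "set Fs \<subseteq> Chains (D_order P)" "length Fs = R l - 1"
    "card (\<Union>(set Fs)) = chain_card P (R l - 1)"
    by (rule chain_card_attained)
  have "Min ?V \<le> val k i j" if "k < l" "i \<le> j" "j < h k" for k i j
    using fin that by (intro Min_le) auto
  then have "Min ?V \<le> card (D_elems P - \<Union>(set Fs))"
    using Fs(2) R_pos by (intro uncovered_ge[OF _ Fs(1)]) auto
  then show "chain_card P (R l - 1) + Min ?V = card (D_elems P)"
    using split[OF Es(1)] split[OF Fs(1)] Es(3) Fs(3) kij(4) chain_card_ge[OF Es(1,2)] by linarith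
qed

end

section \<open>Evaluation of the invariant\<close>

text \<open>Grouping the values in consecutive pairs attains the number; it is least because an
  almost rectangular multiset has at most two distinct values.\<close>

lemma r_num_interval:
  assumes Q: "set_mset Q = {a..<a + s}" and "0 < s"
  shows "r_num Q = (s + 1) div 2"
  unfolding r_num_def
proof (rule Least_equality)
  define f where "f i = filter_mset (\<lambda>x. (x - a) div 2 = i) Q" for i
  define Qs where "Qs = map f [0..<(s + 1) div 2]"
  have "sum_list (map f [0..<m]) = filter_mset (\<lambda>x. (x - a) div 2 < m) Q" for m
  proof (induction m)
    case (Suc m)
    then show ?case by (auto simp: f_def multiset_eq_iff less_Suc_eq)
  qed simp
  moreover have "filter_mset (\<lambda>x. (x - a) div 2 < (s + 1) div 2) Q = Q"
    using Q by (auto simp: filter_mset_eq_conv)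
  ultimately have "sum_list Qs = Q" by (simp add: Qs_def)
  moreover have "almost_rectangular (f i)" if "i < (s + 1) div 2" for i
  proof -
    have "a + 2 * i \<in># f i" using that Q by (auto simp: f_def)
    moreover have sub: "set_mset (f i) \<subseteq> {a + 2 * i..a + 2 * i + 1}" using Q by (auto simp: f_def)
    ultimately have "Max_mset (f i) \<le> a + 2 * i + 1" "a + 2 * i \<le> Min_mset (f i)" "f i \<noteq> {#}"
      by (auto intro!: Max.boundedI Min.boundedI)
    then show ?thesis unfolding almost_rectangular_def by linarith
  qed
  ultimately show "\<exists>Qs. length Qs = (s + 1) div 2 \<and> sum_list Qs = Q \<and> (\<forall>Q\<in>set Qs. almost_rectangular Q)"
    by (intro exI[of _ Qs]) (auto simp: Qs_def)
next
  fix m assume "\<exists>Qs. length Qs = m \<and> sum_list Qs = Q \<and> (\<forall>Q\<in>set Qs. almost_rectangular Q)"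
  then obtain Qs where Qs: "length Qs = m" "sum_list Qs = Q" "\<forall>Q\<in>set Qs. almost_rectangular Q" by blast
  have two: "card (set_mset A) \<le> 2" if "almost_rectangular A" for A
  proof -
    have "set_mset A \<subseteq> {Min_mset A..Min_mset A + 1}"
    proof
      fix x assume "x \<in># A"
      then have "Min_mset A \<le> x" "x \<le> Max_mset A" by auto
      then show "x \<in> {Min_mset A..Min_mset A + 1}" using that by (auto simp: almost_rectangular_def)
    qed
    then show ?thesis using card_mono[of "{Min_mset A..Min_mset A + 1}"] by fastforce
  qed
  have "\<forall>Q\<in>set Qs. almost_rectangular Q \<Longrightarrow> card (set_mset (sum_list Qs)) \<le> 2 * length Qs" for Qs
  proof (induction Qs)
    case (Cons A As)
    then show ?case using card_Un_le[of "set_mset A" "set_mset (sum_list As)"] two[of A] by simp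
  qed simp
  then show "(s + 1) div 2 \<le> m" using Qs Q by fastforce
qed

lemma set_shift_interval:
  assumes "set_mset Q = {a..<a + s}" "c \<le> a"
  shows "set_mset (shift_parts Q c) = {a - c..<a - c + s}"
proof -
  have "x \<in> (\<lambda>x. x - c) ` {a..<a + s}" if "x \<in> {a - c..<a - c + s}" for x
    using that assms(2) by (intro image_eqI[of _ _ "x + c"]) auto
  then show ?thesis using assms by (auto simp: shift_parts_def)
qed

lemma count_shift_parts:
  assumes "\<And>x. x \<in># Q \<Longrightarrow> c \<le> x"
  shows "count (shift_parts Q c) y = count Q (y + c)"
  using assms
proof (induction Q)
  case (add x Q)
  then have "c \<le> x" by simp
  then show ?case using add by (auto simp: shift_parts_def)
qed (simp add: shift_parts_def)

text \<open>The shift lowers the coefficients but keeps the multiplicities, as \<open>c < a\<close>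
  excludes truncation. The indices start at 0 here and at 1 in \<open>mu_spread\<close>.\<close>

lemma mu_spread_shift:
  assumes Q: "set_mset Q = {a..<a + s}" and "0 < s" and "c < a"
  shows "mu_spread (shift_parts Q c) =
    Min {(a - c) * count Q (a + 2 * i) + (a - c + 1) * count Q (a + 2 * j + 1) |i j.
      i \<le> j \<and> j < (s + 1) div 2}"
proof -
  let ?S = "shift_parts Q c"
  have set: "set_mset ?S = {a - c..<a - c + s}" using set_shift_interval[OF Q] \<open>c < a\<close> by simp
  have mn: "Min_mset ?S = a - c" using spread_minmax(1)[OF set] \<open>0 < s\<close> by simp
  have r: "r_num ?S = (s + 1) div 2" using r_num_interval[OF set] \<open>0 < s\<close> by simp
  have mult: "mult ?S (Suc n) = count Q (a + n)" for n
    using count_shift_parts[of Q c] Q \<open>c < a\<close> by (simp add: mult_def mn)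
  have mult': "mult ?S (2 * Suc i - 1) = count Q (a + 2 * i)"
    "mult ?S (2 * Suc i) = count Q (a + 2 * i + 1)" for i
    using mult[of "2 * i"] mult[of "2 * i + 1"] by simp_all
  have "{(a - c) * mult ?S (2 * i - 1) + (a - c + 1) * mult ?S (2 * j) |i j.
      1 \<le> i \<and> i \<le> j \<and> j \<le> (s + 1) div 2} =
    {(a - c) * count Q (a + 2 * i) + (a - c + 1) * count Q (a + 2 * j + 1) |i j.
      i \<le> j \<and> j < (s + 1) div 2}" (is "?A = ?B")
  proof
    show "?A \<subseteq> ?B"
    proof
      fix x assume "x \<in> ?A"
      then obtain i j where x: "x = (a - c) * mult ?S (2 * i - 1) + (a - c + 1) * mult ?S (2 * j)"
        "1 \<le> i" "i \<le> j" "j \<le> (s + 1) div 2" by blast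
      then obtain i' j' where ij: "i = Suc i'" "j = Suc j'" by (metis One_nat_def Suc_le_D order_trans)
      have "x = (a - c) * count Q (a + 2 * i') + (a - c + 1) * count Q (a + 2 * j' + 1)"
        using x(1) by (simp only: ij mult')
      moreover have "i' \<le> j'" "j' < (s + 1) div 2" using x(3,4) ij by simp_all
      ultimately show "x \<in> ?B" by blast
    qed
    show "?B \<subseteq> ?A"
    proof
      fix x assume "x \<in> ?B"
      then obtain i j where x: "x = (a - c) * count Q (a + 2 * i) + (a - c + 1) * count Q (a + 2 * j + 1)"
        "i \<le> j" "j < (s + 1) div 2" by blast
      then have "x = (a - c) * mult ?S (2 * Suc i - 1) + (a - c + 1) * mult ?S (2 * Suc j)"
        by (simp only: mult')
      moreover have "1 \<le> Suc i" "Suc i \<le> Suc j" "Suc j \<le> (s + 1) div 2" using x by simp_all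
      ultimately show "x \<in> ?A" by blast
    qed
  qed
  then show ?thesis unfolding mu_spread_def mn r Let_def by (rule arg_cong)
qed

lemma Min_of_Mins:
  fixes A :: "nat \<Rightarrow> 'a::linorder set"
  assumes "\<And>k. k < l \<Longrightarrow> finite (A k) \<and> A k \<noteq> {}" and "0 < l"
  shows "Min {Min (A k) |k. k < l} = Min (\<Union>k<l. A k)"
proof -
  let ?U = "\<Union>k<l. A k"
  have fin: "finite ?U" using assms(1) by auto
  have "?U \<noteq> {}" using assms by auto
  then have "Min ?U \<in> ?U" by (rule Min_in[OF fin])
  then obtain k where k: "k < l" "Min ?U \<in> A k" by blast
  have lower: "Min ?U \<le> y" if "y \<in> A k" "k < l" for y k
    using that fin by (intro Min_le) auto
  have eq: "Min (A k) = Min ?U" using k assms(1)[OF k(1)] lower by (intro Min_eqI) auto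
  show ?thesis
  proof (rule Min_eqI)
    show "Min ?U \<in> {Min (A k) |k. k < l}" unfolding eq[symmetric] using k(1) by blast
    fix y assume "y \<in> {Min (A k) |k. k < l}"
    then obtain k where k: "k < l" "y = Min (A k)" by blast
    then have "y \<in> A k" using assms(1)[OF k(1)] by simp
    then show "Min ?U \<le> y" using lower k(1) by blast
  qed simp
qed

theorem theorem3p19:
  fixes P :: "nat multiset" and n :: nat
  assumes "n > 0" and "is_partition P n"
  shows "min_lam P = mu P"
proof -
  obtain Ps where Ps: "spread_decomp P Ps" using spread_decomp_ex1[OF assms(2)] by blast
  then have the: "(THE Ps. spread_decomp P Ps) = Ps"
    using spread_decomp_ex1[OF assms(2)] by (metis the1_equality)
  define l where "l = length Ps"
  define p where "p k = Min_mset (Ps ! k)" for k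
  define s where "s k = card (set_mset (Ps ! k))" for k
  have P: "P = (\<Sum>k<l. Ps ! k)"
    using Ps sum_list_sum_nth[of Ps] by (simp add: spread_decomp_def l_def atLeast0LessThan)
  have run: "0 < p k" "0 < s k" "set_mset (Ps ! k) = {p k..<p k + s k}" if k: "k < l" for k
  proof -
    have "spread (Ps ! k)" using Ps k by (simp add: spread_decomp_def l_def)
    then obtain a b where ab: "1 \<le> a" "1 \<le> b" "set_mset (Ps ! k) = {a..<a + b}" by (auto simp: spread_def)
    then have "p k = a" "s k = b" using spread_minmax(1)[of "Ps ! k"] by (simp_all add: p_def s_def)
    then show "0 < p k" "0 < s k" "set_mset (Ps ! k) = {p k..<p k + s k}" using ab by simp_all
  qed
  have gap: "p k + s k < p (Suc k)" if k: "Suc k < l" for k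
  proof -
    have "Max_mset (Ps ! k) + 2 \<le> Min_mset (Ps ! Suc k)"
      using Ps k by (simp add: spread_decomp_def l_def successively_conv_nth)
    moreover have "Max_mset (Ps ! k) = p k + s k - 1" using run[of k] k spread_minmax(2) by simp
    ultimately show ?thesis using run(2)[of k] k by (simp add: p_def)
  qed
  interpret run_decomposition P l p s
  proof
    show "0 < l" using assms Ps by (auto simp: l_def spread_decomp_def is_partition_def)
    show "q \<in># P \<longleftrightarrow> (\<exists>k<l. p k \<le> q \<and> q < p k + s k)" for q
      unfolding P set_mset_sum[OF finite_lessThan] using run(3) by auto
  qed (use run gap in auto)
  \<comment> \<open>The range includes \<open>q = p k + s k\<close>, which occurs in
    \<open>val\<close> for odd \<open>s k\<close>; the strict gap keeps it out of the next
    run.\<close>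
  have count: "count P q = count (Ps ! k) q" if k: "k < l" and q: "p k \<le> q" "q \<le> p k + s k" for k q
  proof -
    have "count (Ps ! k') q = 0" if "k' < l" "k' \<noteq> k" for k'
    proof -
      have "q \<notin> {p k'..<p k' + s k'}"
        using gap_less[of k k'] gap_less[of k' k] that k q by (cases "k < k'") auto
      then show ?thesis using run(3)[OF that(1)] by (simp add: not_in_iff[symmetric])
    qed
    then have "count P q = (\<Sum>k'<l. if k' = k then count (Ps ! k) q else 0)"
      unfolding P count_sum by (intro sum.cong) auto
    then show ?thesis using k by simp
  qed
  have rbar: "rbar Ps k = R k" if "k \<le> l" for k
    unfolding rbar_def R_def h_def
    using that run r_num_interval by (intro sum.cong) auto
  let ?A = "\<lambda>k. {val k i j |i j. i \<le> j \<and> j < h k}"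
  have mu: "mu_spread (shift_parts (Ps ! k) (2 * rbar Ps k)) = Min (?A k)" if k: "k < l" for k
  proof -
    have eq: "val k i j = (p k - 2 * R k) * count (Ps ! k) (p k + 2 * i) +
      (p k - 2 * R k + 1) * count (Ps ! k) (p k + 2 * j + 1)" if "i \<le> j" "j < h k" for i j
      using that by (simp add: val_def w_def h_def count[OF k])
    then have "?A k = {(p k - 2 * R k) * count (Ps ! k) (p k + 2 * i) +
      (p k - 2 * R k + 1) * count (Ps ! k) (p k + 2 * j + 1) |i j. i \<le> j \<and> j < h k}"
      by (intro Collect_cong ex_cong1) (auto simp: eq)
    then show ?thesis
      using mu_spread_shift[OF run(3)[OF k] run(2)[OF k] R_less[OF k]] k by (simp add: rbar h_def)
  qed
  have "mu P = Min {mu_spread (shift_parts (Ps ! k) (2 * rbar Ps k)) |k. k < l}"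
    unfolding mu_def Let_def the l_def ..
  also have "{mu_spread (shift_parts (Ps ! k) (2 * rbar Ps k)) |k. k < l} = {Min (?A k) |k. k < l}"
    by (intro Collect_cong ex_cong1) (auto simp: mu)
  also have "Min \<dots> = Min (\<Union>k<l. ?A k)"
  proof (rule Min_of_Mins)
    fix k assume "k < l"
    have "?A k \<subseteq> (\<lambda>(i, j). val k i j) ` ({..<h k} \<times> {..<h k})" by auto
    then have "finite (?A k)" by (rule finite_subset) simp
    moreover have "0 < h k" using s_pos[OF \<open>k < l\<close>] by (simp add: h_def)
    then have "?A k \<noteq> {}" by blast
    ultimately show "finite (?A k) \<and> ?A k \<noteq> {}" ..
  qed (rule l_pos)
  also have "(\<Union>k<l. ?A k) = {val k i j |k i j. k < l \<and> i \<le> j \<and> j < h k}" by blast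
  finally show ?thesis using min_lam_eq by simp
qed

end
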